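(* Let $m\in\mathbb{R}$. The number and type of four-vortex collinear relative equilibria with circulations $\Gamma_1=\Gamma_2=\Gamma_3=1$ and $\Gamma_4=m$ are as follows. (i) If $m>-1/2$, then there are exactly $12$ collinear relative equilibria, one for each possible ordering of the vortices (so all orderings of both Group I and Group II are realized). (ii) If $-1<m\le -1/2$, then there are exactly $6$ collinear relative equilibria, one for each ordering in Group I. (iii) If $m\le -1$, then there are no collinear relative equilibria.
   Context: Planar four-vortex problem: vortices at pairwise distinct positions $z_i\in\mathbb{R}^2$ with circulations $\Gamma_i$, $r_{ij}=\|z_i-z_j\|$. A relative equilibrium is a uniformly rotating solution with angular velocity $\omega\ne 0$ about the center of vorticity $c$; it is identified with its initial configuration, characterized by the equations $$-\omega(z_i-c)=\sum_{j\neq i}\frac{\Gamma_j}{r_{ij}^2}(z_j-z_i),\qquad i=1,2,3,4,$$ for some $\omega\in\mathbb{R}\setminus\{0\}$ and $c\in\mathbb{R}^2$. (When $\Gamma=\sum_i\Gamma_i\neq 0$, the equations force $c=\frac1\Gamma\sum_i\Gamma_i z_i$, the center of vorticity. For $m=0$ the equation for vortex 4 is kept in this form.) It is collinear if all four positions lie on a common line. Relative equilibria are counted up to equivalence under rotation, scaling and translation of the plane. Each class of collinear relative equilibria has a unique representative with $z_i=(x_i,0)$, $x_1=-1$, $x_2=1$. The ordering $(i\ j\ k\ l)$ of this representative means $x_i<x_j<x_k<x_l$. Since $x_1<x_2$, there are 12 possible orderings, divided into two groups. Group I (vortex 4 exterior to the other three): $(1\,2\,3\,4),(4\,3\,1\,2),(4\,1\,2\,3),(1\,3\,2\,4),(3\,1\,2\,4),(4\,1\,3\,2)$.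 Group II (vortex 4 between two of the equal-strength vortices): $(1\,2\,4\,3),(3\,4\,1\,2),(1\,4\,2\,3),(1\,3\,4\,2),(3\,1\,4\,2),(1\,4\,3\,2)$. *)

theory Defs
  imports "HOL-Analysis.Analysis"
begin

text \<open>Vortices are indexed by the four-element type \<open>4\<close>, whose elements are \<open>1, 2, 3, 4\<close>
  (the numeral \<open>4\<close> denotes the same element as \<open>0\<close>).\<close>

type_synonym config = "4 \<Rightarrow> real ^ 2"

text \<open>The real parameter \<open>\<omega>\<close> is the angular velocity and \<open>c\<close> the centre of rotation; when the
  circulations do not sum to \<open>0\<close>, the equations force \<open>c\<close> to be the centre of vorticity.\<close>

definition relative_equilibrium :: "(4 \<Rightarrow> real) \<Rightarrow> config \<Rightarrow> bool" where
  "relative_equilibrium \<Gamma> z \<longleftrightarrow>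
     inj z \<and>
     (\<exists>\<omega> c. \<omega> \<noteq> 0 \<and>
        (\<forall>i. - \<omega> *\<^sub>R (z i - c) =
             (\<Sum>j\<in>UNIV - {i}. (\<Gamma> j / (dist (z i) (z j))\<^sup>2) *\<^sub>R (z j - z i))))"

definition collinear_relative_equilibria :: "(4 \<Rightarrow> real) \<Rightarrow> config set" where
  "collinear_relative_equilibria \<Gamma> = {z. relative_equilibrium \<Gamma> z \<and> collinear (range z)}"

text \<open>Reflections are not included (\<^const>\<open>rotation_matrix\<close> demands determinant 1).\<close>

definition similarity_rel :: "(config \<times> config) set" where
  "similarity_rel =
     {(z, w). \<exists>(Q :: real ^ 2 ^ 2) s b. rotation_matrix Q \<and> s > 0 \<and>
                (\<forall>i. w i = s *\<^sub>R (Q *v z i) + b)}"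

definition collinear_classes :: "(4 \<Rightarrow> real) \<Rightarrow> config set set" where
  "collinear_classes \<Gamma> = collinear_relative_equilibria \<Gamma> // similarity_rel"

definition on_axis :: "(4 \<Rightarrow> real) \<Rightarrow> config" where
  "on_axis x = (\<lambda>i. vector [x i, 0])"

text \<open>The ordering of a class is that of its representative on the horizontal axis with
  \<open>x\<^sub>1 = -1\<close> and \<open>x\<^sub>2 = 1\<close>.\<close>

fun has_ordering :: "config set \<Rightarrow> 4 \<times> 4 \<times> 4 \<times> 4 \<Rightarrow> bool" where
  "has_ordering C (i, j, k, l) \<longleftrightarrow>
     (\<exists>x. on_axis x \<in> C \<and> x 1 = -1 \<and> x 2 = 1 \<and> x i < x j \<and> x j < x k \<and> x k < x l)"

definition group_I :: "(4 \<times> 4 \<times> 4 \<times> 4) set" where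
  "group_I = {(1,2,3,4), (4,3,1,2), (4,1,2,3), (1,3,2,4), (3,1,2,4), (4,1,3,2)}"

definition group_II :: "(4 \<times> 4 \<times> 4 \<times> 4) set" where
  "group_II = {(1,2,4,3), (3,4,1,2), (1,4,2,3), (1,3,4,2), (3,1,4,2), (1,4,3,2)}"

definition one_for_each_ordering :: "config set set \<Rightarrow> (4 \<times> 4 \<times> 4 \<times> 4) set \<Rightarrow> bool" where
  "one_for_each_ordering \<C> S \<longleftrightarrow>
     (\<forall>\<sigma>\<in>S. \<exists>!C. C \<in> \<C> \<and> has_ordering C \<sigma>) \<and>
     (\<forall>C\<in>\<C>. (\<exists>!\<sigma>. has_ordering C \<sigma>) \<and> (\<forall>\<sigma>. has_ordering C \<sigma> \<longrightarrow> \<sigma> \<in> S))"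

definition circulations :: "real \<Rightarrow> 4 \<Rightarrow> real" where
  "circulations m = (\<lambda>i. if i = 4 then m else 1)"

lemma equiv_similarity_rel: "equiv UNIV similarity_rel"
proof (rule equivI)
  show "similarity_rel \<subseteq> UNIV \<times> UNIV" by simp
  show "refl similarity_rel"
  proof (rule refl_onI)
    fix z :: config
    have "rotation_matrix (mat 1 :: real ^ 2 ^ 2)"
      by (simp add: rotation_matrix_def orthogonal_matrix_id)
    moreover have "\<forall>i. z i = 1 *\<^sub>R (mat 1 *v z i) + 0"
      by (simp add: matrix_vector_mul_lid)
    ultimately show "(z, z) \<in> similarity_rel"
      unfolding similarity_rel_def by (force intro: exI[of _ "1::real"])
  qed
  show "sym similarity_rel"
  proof (rule symI)
    fix z w assume "(z, w) \<in> similarity_rel"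
    then obtain Q :: "real ^ 2 ^ 2" and s b where *: "rotation_matrix Q" "s > 0"
        "\<And>i. w i = s *\<^sub>R (Q *v z i) + b"
      unfolding similarity_rel_def by auto
    let ?P = "transpose Q"
    have "rotation_matrix ?P"
      using *(1) by (simp add: rotation_matrix_def orthogonal_matrix_transpose det_transpose)
    moreover have PQ: "?P ** Q = mat 1"
      using *(1) by (simp add: rotation_matrix_def orthogonal_matrix)
    have "z i = (1 / s) *\<^sub>R (?P *v w i) + (- (1 / s)) *\<^sub>R (?P *v b)" for i
    proof -
      have "?P *v w i = s *\<^sub>R z i + ?P *v b"
        using PQ by (simp add: *(3) matrix_vector_right_distrib matrix_vector_mult_scaleR
            matrix_vector_mul_assoc)
      then show ?thesis using *(2) by (simp add: algebra_simps)
    qed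
    ultimately show "(w, z) \<in> similarity_rel"
      unfolding similarity_rel_def using *(2)
      by (auto intro!: exI[of _ ?P] exI[of _ "1 / s"] exI[of _ "(- (1 / s)) *\<^sub>R (?P *v b)"])
  qed
  show "trans similarity_rel"
  proof (rule transI)
    fix z w v assume "(z, w) \<in> similarity_rel" "(w, v) \<in> similarity_rel"
    then obtain Q Q' :: "real ^ 2 ^ 2" and s b s' b' where
        *: "rotation_matrix Q" "s > 0" "\<And>i. w i = s *\<^sub>R (Q *v z i) + b" and
        **: "rotation_matrix Q'" "s' > 0" "\<And>i. v i = s' *\<^sub>R (Q' *v w i) + b'"
      unfolding similarity_rel_def by auto
    have "rotation_matrix (Q' ** Q)"
      using *(1) **(1) by (simp add: rotation_matrix_def orthogonal_matrix_mul det_mul)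
    moreover have "v i = (s' * s) *\<^sub>R ((Q' ** Q) *v z i) + (s' *\<^sub>R (Q' *v b) + b')" for i
      by (simp add: *(3) **(3) matrix_vector_right_distrib matrix_vector_mult_scaleR
          matrix_vector_mul_assoc algebra_simps)
    ultimately show "(z, v) \<in> similarity_rel"
      unfolding similarity_rel_def using *(2) **(2)
      by (auto intro!: exI[of _ "Q' ** Q"] exI[of _ "s' * s"] exI[of _ "s' *\<^sub>R (Q' *v b) + b'"])
  qed
qed

end

theory Submission
  imports Defs
begin

text \<open>Place vortex 4 at the origin and scale so that the centre of rotation is at \<open>1\<close>. The moments
  of the equilibrium equations say that the unit vortices are the roots of a cubic whose
  coefficients depend on \<open>m\<close> and \<open>K = \<omega> (c - x\<^sub>4)\<^sup>2\<close> only, and that \<open>K\<close> is a root of an explicit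
  quadratic. For \<open>m > -1\<close>, Newton's inequality for the roots shows that only the larger root
  \<open>K\<close> can give positions of equal sign (Group I), and the sign of the product of the positions
  shows that only the smaller one can give positions of mixed sign (Group II), which moreover
  needs \<open>m > -1/2\<close>. Conversely, the cubic satisfies a second-order differential equation; it
  turns roots back into equilibria, and it determines the sign of the cubic at its critical
  points, which makes all roots real for the larger \<open>K\<close>. For the smaller \<open>K\<close> the signs
  at \<open>0\<close> and \<open>1 / K\<close> suffice.\<close>

section \<open>The equilibrium equations on a line\<close>

definition balanced :: "real \<Rightarrow> real \<Rightarrow> real \<Rightarrow> real \<Rightarrow> real \<Rightarrow> real \<Rightarrow> real \<Rightarrow> bool" where
  "balanced m \<omega> c p q r y \<longleftrightarrow>
     p \<noteq> q \<and> p \<noteq> r \<and> q \<noteq> r \<and> p \<noteq> y \<and> q \<noteq> y \<and> r \<noteq> y \<and>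
     \<omega> * (p - c) = 1 / (p - q) + 1 / (p - r) + m / (p - y) \<and>
     \<omega> * (q - c) = 1 / (q - p) + 1 / (q - r) + m / (q - y) \<and>
     \<omega> * (r - c) = 1 / (r - p) + 1 / (r - q) + m / (r - y) \<and>
     \<omega> * (y - c) = 1 / (y - p) + 1 / (y - q) + 1 / (y - r)"

text \<open>These two transpositions generate all permutations of the unit vortices.\<close>

lemma balanced_swap:
  assumes "balanced m \<omega> c p q r y"
  shows "balanced m \<omega> c q p r y" "balanced m \<omega> c p r q y"
  using assms unfolding balanced_def by (auto simp: add_ac)

text \<open>Both sides of each equation scale by \<open>1 / a\<close>. Negative \<open>a\<close> is
  included, so reflections are covered too.\<close>

lemma balanced_affine:
  assumes "balanced m \<omega> c p q r y" and a: "a \<noteq> 0"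
  shows "balanced m (\<omega> / a\<^sup>2) (a * c + b) (a * p + b) (a * q + b) (a * r + b) (a * y + b)"
proof -
  have lhs: "\<omega> / a\<^sup>2 * ((a * u + b) - (a * c + b)) = \<omega> * (u - c) / a" for u
    using a by (simp add: field_simps power2_eq_square)
  have rhs: "k / ((a * u + b) - (a * v + b)) = k / (u - v) / a" for k u v
    by (simp flip: right_diff_distrib add: mult.commute)
  from assms show ?thesis
    unfolding balanced_def lhs rhs by (simp add: add_divide_distrib)
qed

text \<open>The three unit-vortex equations are summed with weights 1, position and position
  squared. The mutual terms of a pair then combine to 0, 1 or the sum of its two positions. The
  equation of vortex 4 says that the reciprocal positions add up to \<omega>; this is the second
  claim, and it evaluates the sum with weight 1.\<close>

lemma balanced_moments:
  assumes "balanced m \<omega> 1 p q r 0" and "\<omega> \<noteq> 0"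
  shows "p + q + r = 3 + m"
    and "p * q + p * r + q * r = \<omega> * (p * q * r)"
    and "\<omega> * (p\<^sup>2 + q\<^sup>2 + r\<^sup>2 - (p + q + r)) = 3 + 3 * m"
    and "\<omega> * (p^3 + q^3 + r^3 - (p\<^sup>2 + q\<^sup>2 + r\<^sup>2)) = (2 + m) * (p + q + r)"
proof -
  have d: "p \<noteq> q" "p \<noteq> r" "q \<noteq> r" "p \<noteq> 0" "q \<noteq> 0" "r \<noteq> 0"
    and p: "\<omega> * (p - 1) = 1 / (p - q) + 1 / (p - r) + m / p"
    and q: "\<omega> * (q - 1) = 1 / (q - p) + 1 / (q - r) + m / q"
    and r: "\<omega> * (r - 1) = 1 / (r - p) + 1 / (r - q) + m / r"
    and y: "\<omega> = 1 / p + 1 / q + 1 / r"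
    using assms(1) unfolding balanced_def by auto
  \<comment> \<open>Reciprocals become variables tied to the positions by polynomial relations, so
    that \<open>algebra\<close> applies.\<close>
  define a b c where abc: "a = 1 / (p - q)" "b = 1 / (p - r)" "c = 1 / (q - r)"
  have n: "1 / (q - p) = - a" "1 / (r - p) = - b" "1 / (r - q) = - c"
    unfolding abc by (metis minus_diff_eq minus_divide_right)+
  have e: "a * (p - q) = 1" "b * (p - r) = 1" "c * (q - r) = 1"
    unfolding abc using d by auto
  define u v w where uvw: "u = 1 / p" "v = 1 / q" "w = 1 / r"
  have f: "u * p = 1" "v * q = 1" "w * r = 1"
    unfolding uvw using d by auto
  have p': "\<omega> * (p - 1) = a + b + m * u" and q': "\<omega> * (q - 1) = - a + c + m * v"
    and r': "\<omega> * (r - 1) = - b - c + m * w" and y': "\<omega> = u + v + w"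
    using p q r y unfolding n by (simp_all add: abc uvw)
  have "\<omega> * (p + q + r - (3 + m)) = 0"
    using p' q' r' y' by algebra
  then show "p + q + r = 3 + m" using assms(2) by simp
  show "p * q + p * r + q * r = \<omega> * (p * q * r)"
    using y' f by algebra
  have "\<omega> * (p\<^sup>2 + q\<^sup>2 + r\<^sup>2 - (p + q + r)) =
      \<omega> * (p - 1) * p + \<omega> * (q - 1) * q + \<omega> * (r - 1) * r"
    by algebra
  also have "\<dots> = a * (p - q) + b * (p - r) + c * (q - r) + m * (u * p + v * q + w * r)"
    unfolding p' q' r' by algebra
  finally show "\<omega> * (p\<^sup>2 + q\<^sup>2 + r\<^sup>2 - (p + q + r)) = 3 + 3 * m"
    unfolding e f by simp
  have "\<omega> * (p^3 + q^3 + r^3 - (p\<^sup>2 + q\<^sup>2 + r\<^sup>2)) =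
      \<omega> * (p - 1) * p\<^sup>2 + \<omega> * (q - 1) * q\<^sup>2 + \<omega> * (r - 1) * r\<^sup>2"
    by algebra
  also have "\<dots> = a * (p - q) * (p + q) + b * (p - r) * (p + r) + c * (q - r) * (q + r)
      + m * ((u * p) * p + (v * q) * q + (w * r) * r)"
    unfolding p' q' r' by algebra
  finally show "\<omega> * (p^3 + q^3 + r^3 - (p\<^sup>2 + q\<^sup>2 + r\<^sup>2)) = (2 + m) * (p + q + r)"
    unfolding e f by algebra
qed

text \<open>Here \<open>K = \<omega> (c - y)\<^sup>2\<close> and \<open>g = e\<^sub>3\<close>. The two equations express the second and
  third moments of the equilibrium equations through \<open>e\<^sub>1 = 3 + m\<close> and \<open>e\<^sub>2 = K g\<close>.\<close>

definition admissible :: "real \<Rightarrow> real \<Rightarrow> real \<Rightarrow> bool" where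
  "admissible m K g \<longleftrightarrow>
     2 * K\<^sup>2 * g = (2 + m) * (3 + m) * K - 3 * (1 + m) \<and>
     K * g * ((1 + m) * K - 3) = (3 + m) * (1 + 2 * m)"

text \<open>Monic with e1 = \<open>3 + m\<close>, e2 = \<open>K * g\<close>, e3 = \<open>g\<close>;
  its roots are the unit vortices when vortex 4 is at 0 and the centre of rotation at 1.\<close>

definition vortex_cubic :: "real \<Rightarrow> real \<Rightarrow> real \<Rightarrow> real \<Rightarrow> real" where
  "vortex_cubic m K g t = t^3 - (3 + m) * t\<^sup>2 + K * g * t - g"

text \<open>Newton's identities express the power sums in the moments through e1, e2, e3. The second
  moment yields the first equation of \<open>admissible\<close>, and with it the third moment yields
  the second.\<close>

lemma balanced_imp_admissible:
  assumes "balanced m K 1 p q r 0" and "K \<noteq> 0"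
  shows "admissible m K (p * q * r)"
proof -
  note M = balanced_moments[OF assms]
  define g where "g = p * q * r"
  have e2: "p * q + p * r + q * r = K * g" using M(2) unfolding g_def by simp
  have 1: "2 * K\<^sup>2 * g = (2 + m) * (3 + m) * K - 3 * (1 + m)"
    using M(1,3) e2 by algebra
  have "p^3 + q^3 + r^3 - (p\<^sup>2 + q\<^sup>2 + r\<^sup>2) =
      (3 + m)^3 - 3 * (3 + m) * (K * g) + 3 * g - ((3 + m)\<^sup>2 - 2 * (K * g))"
    using M(1) e2 g_def by algebra
  then have 2: "K * ((3 + m)^3 - 3 * (3 + m) * (K * g) + 3 * g - ((3 + m)\<^sup>2 - 2 * (K * g))) = (2 + m) * (3 + m)"
    using M(1,4) by algebra
  have "K * g * ((1 + m) * K - 3) = (3 + m) * (1 + 2 * m)"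
    using 1 2 by algebra
  with 1 show ?thesis unfolding admissible_def g_def by blast
qed

text \<open>With \<open>P\<close> the cubic this reads
  \<open>t P'' + 2 m P' - 2 K (t^2 - t) P' = - 2 K (3 t + m) P\<close>. At a simple root,
  \<open>P'' / (2 P')\<close> is the sum of the reciprocal differences to the other roots, so the
  left side is the equilibrium equation multiplied by \<open>2 t P'\<close>. Comparing coefficients,
  those of \<open>t^2\<close> and \<open>t\<close> are the two equations of
  \<open>admissible\<close>; the others agree identically.\<close>

lemma vortex_cubic_ode:
  assumes "admissible m K g"
  shows "t * (6 * t - 2 * (3 + m)) + 2 * m * (3 * t\<^sup>2 - 2 * (3 + m) * t + K * g)
       - 2 * K * (t\<^sup>2 - t) * (3 * t\<^sup>2 - 2 * (3 + m) * t + K * g)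
     = - 2 * K * (3 * t + m) * vortex_cubic m K g t"
  using assms unfolding admissible_def vortex_cubic_def by algebra

lemma vortex_cubic_factor:
  assumes "p + q + r = 3 + m" "p * q + p * r + q * r = K * g" "p * q * r = g"
  shows "vortex_cubic m K g t = (t - p) * (t - q) * (t - r)"
  using assms unfolding vortex_cubic_def by algebra

text \<open>Iterated divided differences: subtract two root equations and cancel the nonzero
  difference of the roots.\<close>

lemma three_roots_vieta:
  assumes "p \<noteq> q" "p \<noteq> r" "q \<noteq> r"
    and "vortex_cubic m K g p = 0" "vortex_cubic m K g q = 0" "vortex_cubic m K g r = 0"
  shows "p + q + r = 3 + m" "p * q + p * r + q * r = K * g" "p * q * r = g"
proof -
  have "(p - q) * (p\<^sup>2 + p * q + q\<^sup>2 - (3 + m) * (p + q) + K * g) = 0"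
    using assms(4,5) unfolding vortex_cubic_def by algebra
  then have 1: "p\<^sup>2 + p * q + q\<^sup>2 - (3 + m) * (p + q) + K * g = 0" using assms(1) by simp
  have "(p - r) * (p\<^sup>2 + p * r + r\<^sup>2 - (3 + m) * (p + r) + K * g) = 0"
    using assms(4,6) unfolding vortex_cubic_def by algebra
  then have 2: "p\<^sup>2 + p * r + r\<^sup>2 - (3 + m) * (p + r) + K * g = 0" using assms(2) by simp
  have "(q - r) * (p + q + r - (3 + m)) = 0" using 1 2 by algebra
  then show *: "p + q + r = 3 + m" using assms(3) by simp
  show **: "p * q + p * r + q * r = K * g" using 1 * by algebra
  show "p * q * r = g" using assms(4) * ** unfolding vortex_cubic_def by algebra
qed

text \<open>Converse of \<open>balanced_imp_admissible\<close>: at each root the right side of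
  \<open>vortex_cubic_ode\<close> vanishes, and dividing the left side by \<open>2 t P'\<close>
  recovers the equilibrium equation. The roots are nonzero because their product is
  \<open>g\<close>.\<close>

lemma balanced_of_roots:
  assumes adm: "admissible m K g" and g: "g \<noteq> 0"
    and d: "p \<noteq> q" "p \<noteq> r" "q \<noteq> r"
    and z: "vortex_cubic m K g p = 0" "vortex_cubic m K g q = 0" "vortex_cubic m K g r = 0"
  shows "balanced m K 1 p q r 0"
proof -
  note V = three_roots_vieta[OF d z]
  have nz: "p \<noteq> 0" "q \<noteq> 0" "r \<noteq> 0" using V(3) g by auto
  have eqn: "K * (t - 1) = 1 / (t - u) + 1 / (t - v) + m / t"
    if t: "t \<noteq> u" "t \<noteq> v" "t \<noteq> 0" "t + u + v = 3 + m" "t * u + t * v + u * v = K * g"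
      "vortex_cubic m K g t = 0" for t u v
  proof -
    \<comment> \<open>First and second derivatives of \<open>(t - p) * (t - q) * (t - r)\<close> at
      the root \<open>t\<close>, in terms of the other roots \<open>u\<close> and
      \<open>v\<close>.\<close>
    have 1: "3 * t\<^sup>2 - 2 * (3 + m) * t + K * g = (t - u) * (t - v)"
      and 2: "6 * t - 2 * (3 + m) = 2 * ((t - u) + (t - v))"
      using t(4,5) by algebra+
    have "K * (t - 1) * (t * ((t - u) * (t - v))) =
        t * ((t - u) + (t - v)) + m * ((t - u) * (t - v))"
      using vortex_cubic_ode[OF adm, of t] t(6) unfolding 1 2 by algebra
    moreover have "(1 / a + 1 / b + m / t) * (t * (a * b)) = t * (a + b) + m * (a * b)"
      if "a \<noteq> 0" "b \<noteq> 0" for a b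
      using that t(3) by (simp add: field_simps)
    from this[of "t - u" "t - v"] have "(1 / (t - u) + 1 / (t - v) + m / t) * (t * ((t - u) * (t - v))) =
        t * ((t - u) + (t - v)) + m * ((t - u) * (t - v))"
      using t(1-2) by simp
    ultimately show ?thesis
      using t(1-3) by (metis (no_types, lifting) divisors_zero mult_right_cancel right_minus_eq)
  qed
  \<comment> \<open>The equation of vortex 4 is e2 / e3 = \<open>K\<close>.\<close>
  have "K = 1 / p + 1 / q + 1 / r"
    using V(2,3) nz g by (simp add: field_simps)
  then have "K * (0 - 1) = 1 / (0 - p) + 1 / (0 - q) + 1 / (0 - r)" by simp
  then show ?thesis
    unfolding balanced_def
    using eqn[of p q r] eqn[of q p r] eqn[of r p q] d nz V z
    by (simp add: algebra_simps)
qed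

section \<open>Solutions of the quadratic and roots of the cubic\<close>

text \<open>The result of eliminating \<open>g\<close> from the two equations of
  \<open>admissible\<close>.\<close>

definition admissible_quadratic :: "real \<Rightarrow> real \<Rightarrow> real" where
  "admissible_quadratic m K =
     (1 + m) * ((2 + m) * (3 + m)) * K\<^sup>2 - (10 * m\<^sup>2 + 35 * m + 27) * K + 9 * (1 + m)"

lemma admissible_quadratic_eq_0:
  assumes "admissible m K g"
  shows "admissible_quadratic m K = 0"
  using assms unfolding admissible_def admissible_quadratic_def by algebra

lemma admissible_of_quadratic:
  assumes "admissible_quadratic m K = 0" and K: "K \<noteq> 0"
  shows "admissible m K (((2 + m) * (3 + m) * K - 3 * (1 + m)) / (2 * K\<^sup>2))"
proof -
  define g where "g = ((2 + m) * (3 + m) * K - 3 * (1 + m)) / (2 * K\<^sup>2)"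
  have 1: "2 * K\<^sup>2 * g = (2 + m) * (3 + m) * K - 3 * (1 + m)"
    unfolding g_def using K by simp
  have "K * (K * g * ((1 + m) * K - 3) - (3 + m) * (1 + 2 * m)) = 0"
    using 1 assms(1) unfolding admissible_quadratic_def by algebra
  with 1 K show ?thesis unfolding g_def[symmetric] admissible_def by simp
qed

text \<open>For \<open>m > -1\<close> the coefficients of the quadratic have signs +, -, +, so it is
  positive at every \<open>K \<le> 0\<close>.\<close>

lemma admissible_imp_pos:
  assumes "admissible m K g" and m: "m > -1"
  shows "K > 0"
proof (rule ccontr)
  assume "\<not> K > 0"
  then have "K \<le> 0" by simp
  have "10 * m\<^sup>2 + 35 * m + 27 = 10 * (1 + m)\<^sup>2 + 15 * (1 + m) + 2" by algebra
  moreover have "10 * (1 + m)\<^sup>2 + 15 * (1 + m) + 2 \<ge> 0" using m by (intro add_nonneg_nonneg) auto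
  ultimately have "10 * m\<^sup>2 + 35 * m + 27 \<ge> 0" by simp
  then have "(10 * m\<^sup>2 + 35 * m + 27) * K \<le> 0"
    using \<open>K \<le> 0\<close> by (rule mult_nonneg_nonpos)
  moreover have "(1 + m) * ((2 + m) * (3 + m)) * K\<^sup>2 \<ge> 0" using m by simp
  ultimately have "(1 + m) * ((2 + m) * (3 + m)) * K\<^sup>2 - (10 * m\<^sup>2 + 35 * m + 27) * K \<ge> 0"
    by (meson diff_ge_0_iff_ge order_trans)
  then have "admissible_quadratic m K > 0"
    unfolding admissible_quadratic_def by (rule add_nonneg_pos) (use m in simp)
  then show False using admissible_quadratic_eq_0[OF assms(1)] by simp
qed

text \<open>The first bound is the sign of the first equation of \<open>admissible\<close>. It
  implies \<open>(1 + m) * K < 3\<close>, so for \<open>g < 0\<close> the left side of the second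
  equation is positive, and hence so is \<open>1 + 2 * m\<close>.\<close>

lemma admissible_neg:
  assumes adm: "admissible m K g" and m: "m > -1" and g: "g < 0"
  shows "(2 + m) * (3 + m) * K < 3 * (1 + m)" and "m > -1/2"
proof -
  have K: "K > 0" using admissible_imp_pos[OF adm m] .
  have "2 * K\<^sup>2 * g < 0" using K g by (simp add: mult_pos_neg)
  then show 1: "(2 + m) * (3 + m) * K < 3 * (1 + m)"
    using adm unfolding admissible_def by simp
  have "(1 + m) * ((2 + m) * (3 + m) * K) < (1 + m) * (3 * (1 + m))"
    using 1 m by (intro mult_strict_left_mono) auto
  also have "\<dots> \<le> 3 * ((2 + m) * (3 + m))"
  proof -
    have "3 * ((2 + m) * (3 + m)) - (1 + m) * (3 * (1 + m)) = 9 * (1 + m) + 6" by algebra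
    then show ?thesis using m by simp
  qed
  finally have "((2 + m) * (3 + m)) * ((1 + m) * K) < ((2 + m) * (3 + m)) * 3"
    by (simp add: mult_ac)
  then have "(1 + m) * K < 3"
    using m by (simp only: mult_less_cancel_left_pos[of "(2 + m) * (3 + m)"] mult_pos_pos)
  then have "(K * g) * ((1 + m) * K - 3) > 0"
    using K g by (intro mult_neg_neg) (simp_all add: mult_pos_neg)
  then have "(3 + m) * (1 + 2 * m) > 0"
    using adm unfolding admissible_def by simp
  then show "m > -1/2" using m by (simp add: zero_less_mult_iff)
qed

text \<open>Newton's inequality \<open>e\<^sub>2\<^sup>2 > 3 e\<^sub>1 e\<^sub>3\<close> for the roots separates the two solutions of the quadratic.\<close>

lemma admissible_pos_three_roots:
  fixes p q r :: real
  assumes adm: "admissible m K g" and m: "m > -1" and g: "g > 0"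
    and d: "p \<noteq> q" and e: "p + q + r = 3 + m" "p * q + p * r + q * r = K * g" "p * q * r = g"
  shows "(2 + m) * (3 + m) * K > 9 * m + 21"
proof -
  have nz: "p \<noteq> 0" "q \<noteq> 0" "r \<noteq> 0" using e(3) g by auto
  \<comment> \<open>Newton's inequality as a sum of squares; it is strict since
    \<open>p * r - q * r\<close> is nonzero.\<close>
  have "2 * ((K * g)\<^sup>2 - 3 * (3 + m) * g) =
      (p * q - p * r)\<^sup>2 + (p * q - q * r)\<^sup>2 + (p * r - q * r)\<^sup>2"
    using e by algebra
  also have "\<dots> > 0"
    using d nz by (intro add_nonneg_pos) auto
  finally have "g * (K\<^sup>2 * g - 3 * (3 + m)) > 0"
    by (simp add: power2_eq_square algebra_simps)
  then have "K\<^sup>2 * g > 3 * (3 + m)" using g by (simp add: zero_less_mult_iff)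
  moreover have "2 * (K\<^sup>2 * g) = (2 + m) * (3 + m) * K - 3 * (1 + m)"
    using adm unfolding admissible_def by simp
  ultimately show ?thesis by argo
qed

lemma admissible_quadratic_two_roots:
  assumes "admissible_quadratic m K = 0" "admissible_quadratic m L = 0" "K \<noteq> L" and m: "m > -1"
  shows "(1 + m) * ((2 + m) * (3 + m)) * (K + L) = 10 * m\<^sup>2 + 35 * m + 27"
    and "(2 + m) * (3 + m) * (K * L) = 9"
proof -
  have "(K - L) * ((1 + m) * ((2 + m) * (3 + m)) * (K + L) - (10 * m\<^sup>2 + 35 * m + 27)) = 0"
    using assms(1,2) unfolding admissible_quadratic_def by algebra
  then show *: "(1 + m) * ((2 + m) * (3 + m)) * (K + L) = 10 * m\<^sup>2 + 35 * m + 27"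
    using assms(3) by simp
  have "(1 + m) * ((2 + m) * (3 + m) * (K * L) - 9) = 0"
    using * assms(1) unfolding admissible_quadratic_def by algebra
  then show "(2 + m) * (3 + m) * (K * L) = 9" using m by simp
qed

text \<open>The quadratic takes the value -12 at the threshold
  \<open>K = (9 * m + 21) / ((2 + m) * (3 + m))\<close>, so the threshold separates its two
  roots.\<close>

lemma admissible_quadratic_unique_large:
  assumes "admissible_quadratic m K = 0" "admissible_quadratic m L = 0" and m: "m > -1"
    and "(2 + m) * (3 + m) * K > 9 * m + 21" "(2 + m) * (3 + m) * L > 9 * m + 21"
  shows "K = L"
proof (rule ccontr)
  assume "K \<noteq> L"
  note R = admissible_quadratic_two_roots[OF assms(1,2) \<open>K \<noteq> L\<close> m]
  have "(1 + m) * (((2 + m) * (3 + m) * K - (9 * m + 21)) * ((2 + m) * (3 + m) * L - (9 * m + 21))) > 0"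
    using assms(4,5) m by simp
  also have "(1 + m) * (((2 + m) * (3 + m) * K - (9 * m + 21)) * ((2 + m) * (3 + m) * L - (9 * m + 21)))
      = - 12 * ((2 + m) * (3 + m))"
    using R by algebra
  finally show False using m by (simp add: mult_less_0_iff zero_less_mult_iff)
qed

text \<open>Likewise, for \<open>m > -1/2\<close> the quadratic is negative at the threshold, the
  value of \<open>K\<close> at which \<open>g\<close> changes sign.\<close>

lemma admissible_quadratic_unique_small:
  assumes "admissible_quadratic m K = 0" "admissible_quadratic m L = 0" and m: "m > -1/2"
    and "(2 + m) * (3 + m) * K < 3 * (1 + m)" "(2 + m) * (3 + m) * L < 3 * (1 + m)"
  shows "K = L"
proof (rule ccontr)
  assume "K \<noteq> L"
  have m': "m > -1" using m by simp
  note R = admissible_quadratic_two_roots[OF assms(1,2) \<open>K \<noteq> L\<close> m']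
  have "0 < ((2 + m) * (3 + m) * K - 3 * (1 + m)) * ((2 + m) * (3 + m) * L - 3 * (1 + m))"
    using assms(4,5) by (intro mult_neg_neg) auto
  also have "\<dots> = - 6 * ((2 * m + 1) * (m + 3))"
    using R by algebra
  finally show False using m by (simp add: mult_less_0_iff zero_less_mult_iff)
qed

text \<open>The monic cubic with these roots has alternating coefficients, hence is negative on all
  \<open>t \<le> 0\<close>.\<close>

lemma all_pos_if_symmetric_functions_pos:
  fixes p q r :: real
  assumes e: "p + q + r > 0" "p * q + p * r + q * r > 0" "p * q * r > 0"
  shows "p > 0" "q > 0" "r > 0"
proof -
  have pos: "t > 0" if "(t - p) * (t - q) * (t - r) = 0" for t
  proof (rule ccontr)
    assume "\<not> t > 0"
    then have "t \<le> 0" by simp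
    have "t^3 \<le> 0" using \<open>t \<le> 0\<close> by (simp add: power3_eq_cube mult_nonneg_nonpos)
    moreover have "(p + q + r) * t\<^sup>2 \<ge> 0" using e by simp
    moreover have "(p * q + p * r + q * r) * t \<le> 0"
      using e(2) \<open>t \<le> 0\<close> by (simp add: mult_nonneg_nonpos)
    moreover have "(t - p) * (t - q) * (t - r) =
        t^3 - (p + q + r) * t\<^sup>2 + (p * q + p * r + q * r) * t - p * q * r"
      by algebra
    ultimately show False using that e(3) by linarith
  qed
  show "p > 0" "q > 0" "r > 0" by (rule pos; simp)+
qed

section \<open>Real roots of the cubic from sign changes\<close>

lemma continuous_vortex_cubic: "continuous_on A (vortex_cubic m K g)"
  unfolding vortex_cubic_def by (intro continuous_intros)

lemma vortex_cubic_large: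
  obtains M where "M > b" "vortex_cubic m K g M > 0" "vortex_cubic m K g (- M) < 0"
proof -
  \<comment> \<open>A Cauchy-type bound: beyond it the leading term dominates. The summand
    \<open>\<bar>b\<bar>\<close> secures \<open>M > b\<close>.\<close>
  define M where "M = 1 + \<bar>b\<bar> + \<bar>3 + m\<bar> + \<bar>K * g\<bar> + \<bar>g\<bar>"
  have M: "M \<ge> 1" "M > b" unfolding M_def by auto
  have M2: "M\<^sup>2 \<ge> M" using M by (simp add: power2_eq_square)
  have 1: "\<bar>(3 + m) * M\<^sup>2\<bar> \<le> \<bar>3 + m\<bar> * M\<^sup>2" by (simp add: abs_mult)
  have 2: "\<bar>K * g * M\<bar> \<le> \<bar>K * g\<bar> * M\<^sup>2"
    using M M2 by (simp add: abs_mult mult_left_mono)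
  have 3: "\<bar>g\<bar> \<le> \<bar>g\<bar> * M\<^sup>2" using M by (simp add: mult_le_cancel_left1)
  have "M^3 = M * M\<^sup>2" by (simp add: power3_eq_cube power2_eq_square)
  also have "\<dots> = (1 + \<bar>b\<bar>) * M\<^sup>2 + \<bar>3 + m\<bar> * M\<^sup>2 + \<bar>K * g\<bar> * M\<^sup>2 + \<bar>g\<bar> * M\<^sup>2"
    unfolding M_def by (simp add: algebra_simps)
  finally have 4: "M^3 = (1 + \<bar>b\<bar>) * M\<^sup>2 + \<bar>3 + m\<bar> * M\<^sup>2 + \<bar>K * g\<bar> * M\<^sup>2 + \<bar>g\<bar> * M\<^sup>2" .
  have 5: "(1 + \<bar>b\<bar>) * M\<^sup>2 > 0" using M by simp
  have 6: "vortex_cubic m K g M = M^3 - (3 + m) * M\<^sup>2 + K * g * M - g"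
    "vortex_cubic m K g (- M) = - (M^3) - (3 + m) * M\<^sup>2 - K * g * M - g"
    unfolding vortex_cubic_def by simp_all
  have "vortex_cubic m K g M > 0" "vortex_cubic m K g (- M) < 0"
    using 1 2 3 4 5 unfolding 6 by linarith+
  then show thesis using M that by blast
qed

lemma vortex_cubic_three_roots:
  assumes "a < b" "b < c" "c < d"
    and "vortex_cubic m K g a < 0" "vortex_cubic m K g b > 0"
        "vortex_cubic m K g c < 0" "vortex_cubic m K g d > 0"
  obtains p q r where "a < p" "p < b" "b < q" "q < c" "c < r" "r < d"
    "vortex_cubic m K g p = 0" "vortex_cubic m K g q = 0" "vortex_cubic m K g r = 0"
proof -
  let ?P = "vortex_cubic m K g"
  obtain p where p: "a \<le> p" "p \<le> b" "?P p = 0"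
    using IVT'[of ?P a 0 b] assms continuous_vortex_cubic by auto
  obtain q where q: "b \<le> q" "q \<le> c" "?P q = 0"
    using IVT2'[of ?P c 0 b] assms continuous_vortex_cubic by auto
  obtain r where r: "c \<le> r" "r \<le> d" "?P r = 0"
    using IVT'[of ?P c 0 d] assms continuous_vortex_cubic by auto
  have "p \<noteq> a" "p \<noteq> b" "q \<noteq> b" "q \<noteq> c" "r \<noteq> c" "r \<noteq> d"
    using p(3) q(3) r(3) assms by auto
  then show thesis using p q r that[of p q r] by simp
qed

lemma continuous_admissible_quadratic: "continuous_on A (admissible_quadratic m)"
  unfolding admissible_quadratic_def by (intro continuous_intros)

text \<open>The signs -, +, -, + at 0, the two critical points \<open>s < t\<close> and a large
  \<open>M\<close> produce the roots. The first bound on \<open>K\<close> gives \<open>g > 0\<close>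
  and places both critical points to the right of \<open>- m / 3\<close>; the second makes them real
  and distinct.\<close>

lemma vortex_cubic_roots_pos:
  assumes adm: "admissible m K g" and m: "m > -1"
    and K: "(2 + m) * (3 + m) * K > 9 * m + 21" "m * (3 + m) * K < 9 * (1 + m)"
  obtains p q r where "0 < p" "p < q" "q < r"
    "vortex_cubic m K g p = 0" "vortex_cubic m K g q = 0" "vortex_cubic m K g r = 0"
proof -
  have Kpos: "K > 0" using admissible_imp_pos[OF adm m] .
  have R: "2 * K\<^sup>2 * g = (2 + m) * (3 + m) * K - 3 * (1 + m)"
    using adm unfolding admissible_def by simp
  have "3 * (1 + m) < 9 * m + 21" using m by simp
  from less_trans[OF this K(1)] have "2 * K\<^sup>2 * g > 0" unfolding R by simp
  then have g: "g > 0" using Kpos by (simp add: zero_less_mult_iff)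
  \<comment> \<open>Up to a positive factor, the discriminant of the derivative of the
    cubic.\<close>
  have "2 * K * ((3 + m)\<^sup>2 - 3 * (K * g)) = 9 * (1 + m) - m * (3 + m) * K"
    using R by algebra
  then have "2 * K * ((3 + m)\<^sup>2 - 3 * (K * g)) > 0" using K(2) by simp
  then have disc: "(3 + m)\<^sup>2 - 3 * (K * g) > 0" using Kpos by (simp add: zero_less_mult_iff)
  define h where "h = sqrt ((3 + m)\<^sup>2 - 3 * (K * g)) / 3"
  have h: "h > 0" "9 * h\<^sup>2 = (3 + m)\<^sup>2 - 3 * (K * g)"
    unfolding h_def using disc by (simp_all add: power_divide)
  define s t where "s = (3 + m) / 3 - h" and "t = (3 + m) / 3 + h"
  have st: "3 * s = 3 + m - 3 * h" "3 * t = 3 + m + 3 * h" unfolding s_def t_def by simp_all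
  have P': "3 * u\<^sup>2 - 2 * (3 + m) * u + K * g = 3 * ((u - s) * (u - t))" for u
    using h(2) st by algebra
  have "0 < K * g" using Kpos g by simp
  then have "0 < (0 - s) * (0 - t)" using P'[of 0] by simp
  moreover have "t > 0" using st h m by linarith
  ultimately have s: "s > 0" by (simp add: zero_less_mult_iff)
  \<comment> \<open>The aim is \<open>- m / 3 < s\<close>. The derivative at \<open>- m / 3\<close>
    is \<open>m\<^sup>2 + 2 * m + K * g\<close>, positive by \<open>(2 + m) * K > 1\<close>, and
    \<open>- m / 3 < t\<close>.\<close>
  have "3 + m < 9 * m + 21" using m by simp
  from less_trans[OF this K(1)] have "(3 + m) * ((2 + m) * K) > 3 + m" by (simp add: mult_ac)
  then have "(2 + m) * K > 1" using m by simp
  then have "3 * (1 + m) * ((2 + m) * K - 1) > 0" using m by simp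
  also have "3 * (1 + m) * ((2 + m) * K - 1) = 2 * K * (m\<^sup>2 + 2 * m + K * g)"
    using R by algebra
  finally have "m\<^sup>2 + 2 * m + K * g > 0" using Kpos by (simp add: zero_less_mult_iff)
  moreover have "m\<^sup>2 + 2 * m + K * g = 3 * ((- m / 3 - s) * (- m / 3 - t))"
    unfolding P'[of "- m / 3", symmetric] by (simp add: power2_eq_square field_simps)
  ultimately have "(- m / 3 - s) * (- m / 3 - t) > 0" by simp
  moreover have "- m / 3 - t < 0" using st h m by linarith
  ultimately have ms: "3 * s + m > 0" by (simp add: zero_less_mult_iff)
  then have mt: "3 * t + m > 0" using st h by linarith
  \<comment> \<open>At a critical point the differential equation of \<open>vortex_cubic_ode\<close> forces the cubic
    and its second derivative to have opposite signs.\<close>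
  have "s * (6 * s - 2 * (3 + m)) = - 2 * K * (3 * s + m) * vortex_cubic m K g s"
    using vortex_cubic_ode[OF adm, of s] unfolding P' by simp
  moreover have "s * (6 * s - 2 * (3 + m)) < 0" using s st h by (intro mult_pos_neg) auto
  ultimately have "0 < (2 * K * (3 * s + m)) * vortex_cubic m K g s" by simp
  then have Ps: "vortex_cubic m K g s > 0"
    by (rule zero_less_mult_pos) (use Kpos ms in simp)
  have "t * (6 * t - 2 * (3 + m)) = - 2 * K * (3 * t + m) * vortex_cubic m K g t"
    using vortex_cubic_ode[OF adm, of t] unfolding P' by simp
  moreover have "t * (6 * t - 2 * (3 + m)) > 0" using \<open>t > 0\<close> st h by (intro mult_pos_pos) auto
  ultimately have "0 < (2 * K * (3 * t + m)) * (- vortex_cubic m K g t)" by simp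
  then have "- vortex_cubic m K g t > 0"
    by (rule zero_less_mult_pos) (use Kpos mt in simp)
  then have Pt: "vortex_cubic m K g t < 0" by simp
  obtain M where M: "M > t" "vortex_cubic m K g M > 0" using vortex_cubic_large by blast
  have P0: "vortex_cubic m K g 0 < 0" using g by (simp add: vortex_cubic_def)
  have "s < t" using st h by linarith
  from vortex_cubic_three_roots[OF s this M(1) P0 Ps Pt M(2)]
  obtain p q r where pqr: "0 < p" "p < s" "s < q" "q < t" "t < r"
    "vortex_cubic m K g p = 0" "vortex_cubic m K g q = 0" "vortex_cubic m K g r = 0"
    by blast
  then show thesis using that[of p q r] by simp
qed

text \<open>The quadratic is -12 at the lower threshold \<open>k\<close>. A point
  \<open>l > k\<close> where it is positive, and which respects the upper bound, gives a root in
  between.\<close>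

lemma ex_admissible_large:
  assumes m: "m > -1"
  obtains K g where "admissible m K g"
    "(2 + m) * (3 + m) * K > 9 * m + 21" "m * (3 + m) * K < 9 * (1 + m)" "g > 0"
proof -
  let ?Q = "admissible_quadratic m"
  define S where "S = (2 + m) * (3 + m)"
  have S: "S > 0" unfolding S_def using m by simp
  define k where "k = (9 * m + 21) / S"
  have k: "k > 0" unfolding k_def using S m by simp
  have kS: "S * k = 9 * m + 21" unfolding k_def using S by simp
  have "S * ?Q k = S * (- 12)"
    using kS unfolding admissible_quadratic_def S_def by algebra
  then have "?Q k = - 12" using S by (simp only: mult_cancel_left) simp
  then have Qk: "?Q k < 0" by simp
  have "\<exists>l>k. ?Q l > 0 \<and> m * (3 + m) * l \<le> 9 * (1 + m)"
  proof (cases "m > 0")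
    case True
    \<comment> \<open>The value at which the upper bound on \<open>K\<close> is an equality.\<close>
    define l where "l = 9 * (1 + m) / (m * (3 + m))"
    have l: "m * (3 + m) * l = 9 * (1 + m)" unfolding l_def using True by simp
    have "l > 0" unfolding l_def using True by simp
    have "m * (3 + m) * (2 + m) * (l - k) = 9 * (1 + m) * (2 + m) - m * (9 * m + 21)"
      using l kS unfolding S_def by algebra
    also have "\<dots> = 6 * m + 18" by algebra
    finally have "m * (3 + m) * (2 + m) * (l - k) > 0" using True by simp
    then have "l - k > 0" by (rule zero_less_mult_pos) (use True in simp)
    then have "l > k" by simp
    have "m * ?Q l = l * (4 * m\<^sup>2 + 18 * m + 18)"
      using l unfolding admissible_quadratic_def by algebra
    also have "\<dots> > 0" using \<open>l > 0\<close> True by (simp add: add_pos_pos)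
    finally have "?Q l > 0" using True by (simp add: zero_less_mult_iff)
    with \<open>l > k\<close> l show ?thesis by auto
  next
    case False
    define A where "A = (1 + m) * S"
    have A: "A > 0" unfolding A_def using S m by simp
    \<comment> \<open>The sum of the two roots, where the quadratic equals its constant term. For
      \<open>m \<le> 0\<close> the upper bound holds at every positive \<open>K\<close>.\<close>
    define l where "l = (10 * m\<^sup>2 + 35 * m + 27) / A"
    have l: "A * l = 10 * m\<^sup>2 + 35 * m + 27" unfolding l_def using A by simp
    have "?Q l = 9 * (1 + m)"
      using l unfolding admissible_quadratic_def A_def S_def by algebra
    then have Ql: "?Q l > 0" using m by simp
    have "A * k * (l - k) = 9 * (1 + m) - ?Q k"
      using l unfolding admissible_quadratic_def A_def S_def by algebra
    then have "A * k * (l - k) > 0" using Qk m by simp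
    then have "l - k > 0" by (rule zero_less_mult_pos) (use A k in simp)
    then have "l > k" by simp
    moreover have "m * (3 + m) * l \<le> 0"
      using False m \<open>l > k\<close> k by (simp add: mult_nonpos_nonneg)
    ultimately show ?thesis using Ql m by (intro exI[of _ l]) auto
  qed
  then obtain l where l: "l > k" "?Q l > 0" "m * (3 + m) * l \<le> 9 * (1 + m)" by blast
  obtain K where K: "k \<le> K" "K \<le> l" "?Q K = 0"
    using IVT'[of ?Q k 0 l] Qk l continuous_admissible_quadratic by auto
  have "K \<noteq> k" "K \<noteq> l" using K Qk l by auto
  then have K': "k < K" "K < l" using K by auto
  have "S * K > S * k" using K' S by simp
  then have 1: "(2 + m) * (3 + m) * K > 9 * m + 21" unfolding kS by (simp add: S_def)
  have 2: "m * (3 + m) * K < 9 * (1 + m)"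
  proof (cases "m > 0")
    case True
    then have "m * (3 + m) * K < m * (3 + m) * l" using K' by simp
    then show ?thesis using l by simp
  next
    case False
    have "m * (3 + m) * K \<le> 0"
      using False m K' k by (simp add: mult_nonpos_nonneg)
    then show ?thesis using m by simp
  qed
  have "((2 + m) * (3 + m) * K - 3 * (1 + m)) / (2 * K\<^sup>2) > 0"
    using 1 m K' k by (intro divide_pos_pos) auto
  moreover have "K \<noteq> 0" using K' k by simp
  ultimately show thesis
    using that[OF admissible_of_quadratic[OF K(3)] 1 2] by blast
qed

section \<open>Existence of equilibria with vortex 4 exterior or interior\<close>

lemma ex_balanced_exterior:
  assumes m: "m > -1"
  obtains K p q r where "K \<noteq> 0" "0 < p" "p < q" "q < r" "balanced m K 1 p q r 0"
proof -
  obtain K g where K: "admissible m K g"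
    "(2 + m) * (3 + m) * K > 9 * m + 21" "m * (3 + m) * K < 9 * (1 + m)" "g > 0"
    using ex_admissible_large[OF m] by blast
  obtain p q r where "0 < p" "p < q" "q < r"
    "vortex_cubic m K g p = 0" "vortex_cubic m K g q = 0" "vortex_cubic m K g r = 0"
    using vortex_cubic_roots_pos[OF K(1) m K(2,3)] by blast
  then show thesis
    using that[of K p q r] balanced_of_roots[OF K(1), of p q r] K(4) admissible_imp_pos[OF K(1) m]
    by simp
qed

text \<open>The smaller root \<open>K\<close> lies between \<open>k\<close> and \<open>l\<close>.
  There \<open>K < l\<close> means \<open>g < 0\<close>, so the cubic is positive at 0, and
  \<open>K > k\<close> makes it negative at \<open>1 / K\<close>.\<close>

lemma ex_balanced_interior:
  assumes m: "m > -1/2"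
  obtains K p q r where "K \<noteq> 0" "p < 0" "0 < q" "q < r" "balanced m K 1 p q r 0"
proof -
  let ?Q = "admissible_quadratic m"
  define k where "k = 1 / (3 + m)"
  have k: "(3 + m) * k = 1" "k > 0" unfolding k_def using m by simp_all
  define l where "l = 3 * (1 + m) / ((2 + m) * (3 + m))"
  have l: "(2 + m) * (3 + m) * l = 3 * (1 + m)" "l > 0" unfolding l_def using m by simp_all
  have "(3 + m) * ?Q k = 4 * m + 2"
    using k unfolding admissible_quadratic_def by algebra
  then have "(3 + m) * ?Q k > 0" using m by simp
  then have Qk: "?Q k > 0" using m by (simp add: zero_less_mult_iff)
  have "?Q l = - 2 * ((3 + m) * (1 + 2 * m)) * l"
    using l unfolding admissible_quadratic_def by algebra
  moreover have "(3 + m) * (1 + 2 * m) * l > 0" using l(2) m by simp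
  ultimately have Ql: "?Q l < 0" by (simp add: mult_ac)
  have "(2 + m) * (3 + m) * (l - k) = 1 + 2 * m"
    using k l by algebra
  then have "(2 + m) * (3 + m) * (l - k) > 0" using m by simp
  then have "l - k > 0" by (rule zero_less_mult_pos) (use m in simp)
  then have "k < l" by simp
  then obtain K where K: "k \<le> K" "K \<le> l" "?Q K = 0"
    using IVT2'[of ?Q l 0 k] Qk Ql continuous_admissible_quadratic by auto
  have "K \<noteq> k" "K \<noteq> l" using K Qk Ql by auto
  then have K': "k < K" "K < l" using K by auto
  have Kpos: "K > 0" using k K' by simp
  define g where "g = ((2 + m) * (3 + m) * K - 3 * (1 + m)) / (2 * K\<^sup>2)"
  have adm: "admissible m K g" unfolding g_def using admissible_of_quadratic K(3) Kpos by simp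
  have "(2 + m) * (3 + m) * K < (2 + m) * (3 + m) * l" using K' m by simp
  then have g: "g < 0" unfolding g_def l using Kpos by (simp add: divide_neg_pos)
  have "(3 + m) * K > (3 + m) * k" using K' m by simp
  then have "(3 + m) * K > 1" unfolding k .
  \<comment> \<open>At \<open>1 / K\<close> the linear and constant terms of the cubic
    cancel.\<close>
  have "K^3 * vortex_cubic m K g (1 / K) = 1 - (3 + m) * K"
    unfolding vortex_cubic_def using Kpos by (simp add: field_simps power2_eq_square power3_eq_cube)
  then have "K^3 * vortex_cubic m K g (1 / K) < 0" using \<open>(3 + m) * K > 1\<close> by simp
  then have P1: "vortex_cubic m K g (1 / K) < 0" using Kpos by (simp add: mult_less_0_iff)
  have P0: "vortex_cubic m K g 0 > 0" using g by (simp add: vortex_cubic_def)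
  obtain M where M: "M > 1 / K" "vortex_cubic m K g M > 0" "vortex_cubic m K g (- M) < 0"
    using vortex_cubic_large by blast
  have K1: "0 < 1 / K" using Kpos by simp
  then have M0: "- M < 0" using M(1) by linarith
  from vortex_cubic_three_roots[OF M0 K1 M(1) M(3) P0 P1 M(2)]
  obtain p q r where pqr: "p < 0" "0 < q" "q < 1 / K" "1 / K < r"
    "vortex_cubic m K g p = 0" "vortex_cubic m K g q = 0" "vortex_cubic m K g r = 0"
    by blast
  have "q < r" using pqr by linarith
  then show thesis
    using that[of K p q r] balanced_of_roots[OF adm, of p q r] g Kpos pqr by simp
qed

section \<open>Uniqueness and non-existence\<close>

definition line_equilibrium :: "real \<Rightarrow> real \<Rightarrow> real \<Rightarrow> real \<Rightarrow> real \<Rightarrow> bool" where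
  "line_equilibrium m p q r y \<longleftrightarrow> (\<exists>\<omega> c. \<omega> \<noteq> 0 \<and> balanced m \<omega> c p q r y)"

lemma line_equilibrium_swap:
  assumes "line_equilibrium m p q r y"
  shows "line_equilibrium m q p r y" "line_equilibrium m p r q y"
  using assms balanced_swap unfolding line_equilibrium_def by blast+

lemma line_equilibrium_affine:
  assumes "line_equilibrium m p q r y" "a \<noteq> 0"
  shows "line_equilibrium m (a * p + b) (a * q + b) (a * r + b) (a * y + b)"
proof -
  obtain \<omega> c where "\<omega> \<noteq> 0" "balanced m \<omega> c p q r y"
    using assms(1) unfolding line_equilibrium_def by blast
  then have "\<omega> / a\<^sup>2 \<noteq> 0"
    "balanced m (\<omega> / a\<^sup>2) (a * c + b) (a * p + b) (a * q + b) (a * r + b) (a * y + b)"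
    using balanced_affine assms(2) by auto
  then show ?thesis unfolding line_equilibrium_def by blast
qed

lemma line_equilibrium_uminus:
  assumes "line_equilibrium m p q r y"
  shows "line_equilibrium m (- p) (- q) (- r) (- y)"
  using line_equilibrium_affine[OF assms, of "-1" 0] by simp

lemma balanced_distinct:
  assumes "balanced m \<omega> c p q r y"
  shows "p \<noteq> q" "p \<noteq> r" "q \<noteq> r" "p \<noteq> y" "q \<noteq> y" "r \<noteq> y"
  using assms unfolding balanced_def by blast+

lemma line_equilibrium_distinct:
  assumes "line_equilibrium m p q r y"
  shows "p \<noteq> q" "p \<noteq> r" "q \<noteq> r" "p \<noteq> y" "q \<noteq> y" "r \<noteq> y"
proof -
  obtain \<omega> c where "balanced m \<omega> c p q r y"
    using assms unfolding line_equilibrium_def by blast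
  from balanced_distinct[OF this]
  show "p \<noteq> q" "p \<noteq> r" "q \<noteq> r" "p \<noteq> y" "q \<noteq> y" "r \<noteq> y" .
qed

text \<open>For \<open>m \<le> -1\<close> the pair formed by vortex 4 and a neighbouring unit vortex forces
  \<open>\<omega> < 0\<close>, whereas a suitable pair of unit vortices forces \<open>\<omega> > 0\<close>.\<close>

lemma not_line_equilibrium_sorted:
  assumes m: "m \<le> -1" and ord: "p < q" "q < r" and y: "y < p \<or> p < y \<and> y < q"
  shows "\<not> line_equilibrium m p q r y"
proof
  assume "line_equilibrium m p q r y"
  then obtain \<omega> c where B: "balanced m \<omega> c p q r y" unfolding line_equilibrium_def by blast
  have inv: "1 / b < 1 / a" if "a < b" "0 < a \<or> b < 0" for a b :: real
    using that by (auto intro: divide_strict_left_mono divide_strict_left_mono_neg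
        simp: mult_pos_pos mult_neg_neg frac_less2 field_simps)
  have P: "\<omega> * (p - c) = 1 / (p - q) + 1 / (p - r) + m / (p - y)"
    and Q: "\<omega> * (q - c) = 1 / (q - p) + 1 / (q - r) + m / (q - y)"
    and R: "\<omega> * (r - c) = 1 / (r - p) + 1 / (r - q) + m / (r - y)"
    and Y: "\<omega> * (y - c) = 1 / (y - p) + 1 / (y - q) + 1 / (y - r)"
    using B unfolding balanced_def by auto
  have flip: "k / (b - a) = - (k / (a - b))" for a b k :: real
    by (metis minus_diff_eq minus_divide_right)
  have split_m: "(1 + m) / a = 1 / a + m / a" for a :: real
    by (rule add_divide_distrib)
  from y show False
  proof
    assume "y < p"
    \<comment> \<open>The equations of \<open>p\<close> and \<open>r\<close> give \<omega> > 0: in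
      their difference vortex 4 contributes at most 0, since \<open>m\<close> is negative, and the
      unit vortices contribute negative terms.\<close>
    have "m / (p - y) \<le> m / (r - y)"
      using m ord \<open>y < p\<close> inv[of "p - y" "r - y"] mult_left_mono_neg[of "1 / (r - y)" "1 / (p - y)" m]
      by simp
    moreover have "1 / (p - q) < 0" "1 / (p - r) < 0" "1 / (r - q) > 0" "1 / (r - p) > 0"
      using ord by simp_all
    moreover have "\<omega> * (p - r) = \<omega> * (p - c) - \<omega> * (r - c)" by (simp add: algebra_simps)
    ultimately have "\<omega> * (p - r) < 0" unfolding P R by linarith
    then have "\<omega> > 0" using ord by (simp add: mult_less_0_iff)
    \<comment> \<open>The mutual terms of vortex 4 and its neighbour \<open>p\<close> combine with
      weight \<open>1 + m \<le> 0\<close>; the other differences have the sign that forces \<omega>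
      < 0.\<close>
    have "\<omega> * (y - p) = \<omega> * (y - c) - \<omega> * (p - c)" by (simp add: algebra_simps)
    also have "\<dots> = (1 + m) / (y - p) + (1 / (y - q) - 1 / (p - q)) + (1 / (y - r) - 1 / (p - r))"
      unfolding P Y split_m flip[of m p y] by simp
    also have "\<dots> > 0"
    proof -
      have "(1 + m) / (y - p) \<ge> 0" using m \<open>y < p\<close> by (intro divide_nonpos_neg) auto
      moreover have "1 / (y - q) > 1 / (p - q)" "1 / (y - r) > 1 / (p - r)"
        using inv[of "y - q" "p - q"] inv[of "y - r" "p - r"] ord \<open>y < p\<close> by auto
      ultimately show ?thesis by linarith
    qed
    finally have "\<omega> * (y - p) > 0" .
    moreover have "\<omega> * (y - p) < 0" using \<open>\<omega> > 0\<close> \<open>y < p\<close> by (intro mult_pos_neg) auto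
    ultimately show False by simp
  next
    assume "p < y \<and> y < q"
    then have y: "p < y" "y < q" by auto
    \<comment> \<open>Now the pair \<open>q\<close>, \<open>r\<close> gives \<omega> > 0: vortex 4
      is closer to both than \<open>p\<close>, so with weight \<open>m \<le> -1\<close> its
      contribution at least cancels that of \<open>p\<close>.\<close>
    have "1 / (q - p) - 1 / (r - p) = (r - q) / ((q - p) * (r - p))"
      using ord by (simp add: field_simps)
    also have "\<dots> \<le> (r - q) / ((q - y) * (r - y))"
      using ord y by (intro divide_left_mono mult_mono) auto
    also have "\<dots> = 1 / (q - y) - 1 / (r - y)"
      using ord y by (simp add: field_simps)
    finally have 1: "1 / (q - p) - 1 / (r - p) \<le> 1 / (q - y) - 1 / (r - y)" .
    have 2: "1 / (q - y) - 1 / (r - y) > 0" using inv[of "q - y" "r - y"] ord y by simp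
    have "(1 + m) * (1 / (q - y) - 1 / (r - y)) \<le> 0"
      using 2 m by (intro mult_nonpos_nonneg) auto
    moreover have "m / (q - y) - m / (r - y) = m * (1 / (q - y) - 1 / (r - y))"
      by (simp add: right_diff_distrib)
    ultimately have "(1 / (q - y) - 1 / (r - y)) + (m / (q - y) - m / (r - y)) \<le> 0"
      by (simp only: distrib_right mult_1_left)
    with 1 have 3: "1 / (q - p) - 1 / (r - p) + (m / (q - y) - m / (r - y)) \<le> 0" by linarith
    have "1 / (q - r) < 0" "1 / (r - q) > 0" using ord by simp_all
    moreover have "\<omega> * (q - r) = \<omega> * (q - c) - \<omega> * (r - c)" by (simp add: algebra_simps)
    ultimately have "\<omega> * (q - r) < 0" unfolding Q R using 3 by linarith
    then have "\<omega> > 0" using ord by (simp add: mult_less_0_iff)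
    \<comment> \<open>The same cancellation with weight \<open>1 + m\<close>, now for vortex 4 and
      its neighbour \<open>q\<close>.\<close>
    have "\<omega> * (q - y) = \<omega> * (q - c) - \<omega> * (y - c)" by (simp add: algebra_simps)
    also have "\<dots> = (1 + m) / (q - y) + ((1 / (q - p) - 1 / (y - p)) + (1 / (q - r) - 1 / (y - r)))"
      unfolding Q Y split_m flip[of 1 y q] by simp
    also have "\<dots> < 0"
    proof -
      have "(1 + m) / (q - y) \<le> 0" using m y by (intro divide_nonpos_pos) auto
      moreover have "1 / (q - p) < 1 / (y - p)" "1 / (q - r) < 1 / (y - r)"
        using inv[of "y - p" "q - p"] inv[of "y - r" "q - r"] ord y by auto
      ultimately show ?thesis by linarith
    qed
    finally have "\<omega> * (q - y) < 0" .
    moreover have "\<omega> * (q - y) > 0" using \<open>\<omega> > 0\<close> y by (intro mult_pos_pos) auto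
    ultimately show False by simp
  qed
qed

text \<open>Permuting the unit vortices sorts them, and the reflection about 0 moves vortex 4 into
  one of the two leftmost gaps.\<close>

lemma not_line_equilibrium:
  assumes m: "m \<le> -1"
  shows "\<not> line_equilibrium m p q r y"
proof
  assume E: "line_equilibrium m p q r y"
  have *: False if E: "line_equilibrium m p q r y" and ord: "p < q" "q < r" for p q r
  proof -
    note d = line_equilibrium_distinct[OF E]
    have "line_equilibrium m (- r) (- q) (- p) (- y)"
      by (rule line_equilibrium_swap(1)[OF line_equilibrium_swap(2)[OF
            line_equilibrium_swap(1)[OF line_equilibrium_uminus[OF E]]]])
    then have "\<not> (- y < - r \<or> - r < - y \<and> - y < - q)"
      using not_line_equilibrium_sorted[OF m, of "- r" "- q" "- p" "- y"] ord by auto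
    moreover have "\<not> (y < p \<or> p < y \<and> y < q)"
      using not_line_equilibrium_sorted[OF m, of p q r y] ord E by auto
    ultimately show False using d by linarith
  qed
  have E': "line_equilibrium m p r q y" "line_equilibrium m q p r y" "line_equilibrium m q r p y"
    "line_equilibrium m r p q y" "line_equilibrium m r q p y"
    by (simp_all add: E line_equilibrium_swap(1)[OF E] line_equilibrium_swap(2)[OF E]
        line_equilibrium_swap(1)[OF line_equilibrium_swap(2)[OF E]]
        line_equilibrium_swap(2)[OF line_equilibrium_swap(1)[OF E]]
        line_equilibrium_swap(1)[OF line_equilibrium_swap(2)[OF line_equilibrium_swap(1)[OF E]]])
  note d = line_equilibrium_distinct(1-3)[OF E]
  consider "p < q" "q < r" | "p < r" "r < q" | "q < p" "p < r" | "q < r" "r < p"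
    | "r < p" "p < q" | "r < q" "q < p"
    using d by linarith
  then show False
  proof cases
    case 1 then show False by (rule *[OF E])
  next
    case 2 then show False by (rule *[OF E'(1)])
  next
    case 3 then show False by (rule *[OF E'(2)])
  next
    case 4 then show False by (rule *[OF E'(3)])
  next
    case 5 then show False by (rule *[OF E'(4)])
  next
    case 6 then show False by (rule *[OF E'(5)])
  qed
qed

text \<open>If \<open>c\<close> coincided with vortex 4, then \<open>e\<^sub>1 = e\<^sub>2 = 0\<close> and the positions would all vanish.\<close>

lemma line_equilibrium_scaled:
  assumes "line_equilibrium m p q r y"
  obtains k K where "k \<noteq> 0" "K \<noteq> 0"
    "balanced m K 1 ((p - y) / k) ((q - y) / k) ((r - y) / k) 0"
proof -
  obtain \<omega> c where w: "\<omega> \<noteq> 0" and B: "balanced m \<omega> c p q r y"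
    using assms unfolding line_equilibrium_def by blast
  have B0: "balanced m \<omega> (c - y) (p - y) (q - y) (r - y) 0"
    using balanced_affine[OF B, of 1 "- y"] by simp
  have "c - y \<noteq> 0"
  proof
    assume c: "c - y = 0"
    define u v w where "u = p - y" and "v = q - y" and "w = r - y"
    have B1: "balanced m \<omega> 0 u v w 0" using B0 unfolding c u_def v_def w_def .
    note d = balanced_distinct(4-6)[OF B1]
    have "\<omega> * (0 - 0) = 1 / (0 - u) + 1 / (0 - v) + 1 / (0 - w)"
      using B1 unfolding balanced_def by blast
    then have e: "1 / u + 1 / v + 1 / w = 0" by simp
    have flip: "1 / (v - u) = - (1 / (u - v))" "1 / (w - u) = - (1 / (u - w))"
      "1 / (w - v) = - (1 / (v - w))"
      by (metis minus_diff_eq minus_divide_right)+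
    have "\<omega> * (u - 0) = 1 / (u - v) + 1 / (u - w) + m / (u - 0)"
      "\<omega> * (v - 0) = - (1 / (u - v)) + 1 / (v - w) + m / (v - 0)"
      "\<omega> * (w - 0) = - (1 / (u - w)) + - (1 / (v - w)) + m / (w - 0)"
      using B1 unfolding balanced_def flip by blast+
    then have "\<omega> * u + \<omega> * v + \<omega> * w = m / u + m / v + m / w"
      by simp
    also have "\<dots> = m * (1 / u + 1 / v + 1 / w)" by (simp add: algebra_simps)
    finally have "\<omega> * (u + v + w) = 0" unfolding e by (simp add: algebra_simps)
    then have s: "u + v + w = 0" using \<open>\<omega> \<noteq> 0\<close> by simp
    have "u * v + u * w + v * w = u * v * w * (1 / u + 1 / v + 1 / w)"
      using d by (simp add: field_simps)
    then have "u * v + u * w + v * w = 0" unfolding e by simp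
    then have "u\<^sup>2 + v\<^sup>2 + w\<^sup>2 = 0" using s by algebra
    moreover have "u\<^sup>2 > 0" using d by simp
    ultimately show False by (smt (verit) zero_le_power2)
  qed
  \<comment> \<open>Dividing by \<open>c - y\<close> puts the centre at 1; this factor may be
    negative and then reverses the order.\<close>
  moreover have "balanced m (\<omega> * (c - y)\<^sup>2) 1 ((p - y) / (c - y)) ((q - y) / (c - y)) ((r - y) / (c - y)) 0"
    using balanced_affine[OF B0, of "1 / (c - y)" 0] calculation by (simp add: power_divide)
  ultimately show thesis using w that[of "c - y" "\<omega> * (c - y)\<^sup>2"] by simp
qed

text \<open>If e3 > 0, then e2 = \<open>K\<close> e3 > 0 and e1 = \<open>3 + m\<close> > 0. Together
  with \<open>balanced_not_all_neg\<close>, the sign of the product tells exterior from interior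
  positions of vortex 4.\<close>

lemma balanced_product_pos_iff:
  assumes B: "balanced m K 1 p q r 0" and K: "K \<noteq> 0" and m: "m > -1"
  shows "p * q * r > 0 \<longleftrightarrow> p > 0 \<and> q > 0 \<and> r > 0"
proof
  assume g: "p * q * r > 0"
  note M = balanced_moments[OF B K]
  have "K > 0" using admissible_imp_pos[OF balanced_imp_admissible[OF B K] m] .
  then have "p * q + p * r + q * r > 0" unfolding M(2) using g by simp
  then show "p > 0 \<and> q > 0 \<and> r > 0"
    using all_pos_if_symmetric_functions_pos[of p q r] g M(1) m by simp
qed simp

lemma balanced_not_all_neg:
  assumes "balanced m K 1 p q r 0" and "K \<noteq> 0" and "m > -1"
  shows "\<not> (p < 0 \<and> q < 0 \<and> r < 0)"
  using balanced_moments(1)[OF assms(1,2)] assms(3) by linarith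

text \<open>The factors \<open>k\<close>, \<open>k'\<close> undo the scaling, so the hypotheses say
  that the original configurations, vortex 4 included, are ordered alike. The order determines the
  sign of \<open>k\<close> and which root of the quadratic \<open>K\<close> is, hence the cubic, and
  finally which root belongs to which vortex.\<close>

lemma balanced_scaled_unique:
  assumes m: "m > -1" and k: "k \<noteq> 0" "k' \<noteq> 0"
    and B: "balanced m K 1 p q r 0" "K \<noteq> 0" and B': "balanced m K' 1 p' q' r' 0" "K' \<noteq> 0"
    and s: "k * p < 0 \<longleftrightarrow> k' * p' < 0" "k * q < 0 \<longleftrightarrow> k' * q' < 0" "k * r < 0 \<longleftrightarrow> k' * r' < 0"
    and o: "k * p < k * q \<longleftrightarrow> k' * p' < k' * q'" "k * p < k * r \<longleftrightarrow> k' * p' < k' * r'"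
      "k * q < k * r \<longleftrightarrow> k' * q' < k' * r'"
  shows "p' = p" "q' = q" "r' = r"
proof -
  note M = balanced_moments[OF B] and M' = balanced_moments[OF B']
  note A = balanced_imp_admissible[OF B] and A' = balanced_imp_admissible[OF B']
  note d = balanced_distinct(4-6)[OF B(1)] balanced_distinct(4-6)[OF B'(1)]
    balanced_distinct(1-3)[OF B(1)] balanced_distinct(1-3)[OF B'(1)]
  note S = balanced_product_pos_iff[OF B m] balanced_product_pos_iff[OF B' m]
    balanced_not_all_neg[OF B m] balanced_not_all_neg[OF B' m]
  have sg: "u < 0 \<longleftrightarrow> (k > 0 \<longleftrightarrow> k' > 0) = (u' < 0)"
    if "k * u < 0 \<longleftrightarrow> k' * u' < 0" "u \<noteq> 0" "u' \<noteq> 0" for u u'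
    using that k by (cases "k > 0"; cases "k' > 0") (auto simp: mult_less_0_iff)
  note sg = sg[OF s(1) d(1,4)] sg[OF s(2) d(2,5)] sg[OF s(3) d(3,6)]
  have pos: "u > 0 \<longleftrightarrow> \<not> u < 0" if "u \<noteq> 0" for u :: real using that by linarith
  note pos = d(1-6)[THEN pos]
  \<comment> \<open>A positive product means that the three signs agree, a property unchanged when
    all signs flip.\<close>
  have g: "p * q * r > 0 \<longleftrightarrow> p' * q' * r' > 0"
    using sg S(3,4) unfolding S(1,2) pos by blast
  \<comment> \<open>Opposite signs of \<open>k\<close> and \<open>k'\<close> would flip three signs
    and thus the sign of the product.\<close>
  have kk: "k > 0 \<longleftrightarrow> k' > 0"
  proof (rule ccontr)
    assume "\<not> (k > 0 \<longleftrightarrow> k' > 0)"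
    then have n: "(p < 0) \<noteq> (p' < 0)" "(q < 0) \<noteq> (q' < 0)" "(r < 0) \<noteq> (r' < 0)"
      using sg by blast+
    have prod: "u * v * w > 0 \<longleftrightarrow> ((u < 0) = (v < 0)) = (\<not> w < 0)"
      if "u \<noteq> 0" "v \<noteq> 0" "w \<noteq> 0" for u v w :: real
      using that by (cases "u < 0"; cases "v < 0"; cases "w < 0")
        (auto simp: zero_less_mult_iff mult_less_0_iff)
    show False
      using g n unfolding prod[OF d(1-3)] prod[OF d(4-6)] by blast
  qed
  note Q = admissible_quadratic_eq_0[OF A] admissible_quadratic_eq_0[OF A']
  \<comment> \<open>A positive product selects the larger root of the quadratic, a negative one the
    smaller.\<close>
  have "K = K'"
  proof (cases "p * q * r > 0")
    case True
    then show ?thesis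
      using admissible_quadratic_unique_large[OF Q m]
        admissible_pos_three_roots[OF A m _ d(7) M(1,2) refl]
        admissible_pos_three_roots[OF A' m _ d(10) M'(1,2) refl] g by simp
  next
    case False
    moreover have "p * q * r \<noteq> 0" "p' * q' * r' \<noteq> 0" using d by simp_all
    ultimately have "p * q * r < 0" "p' * q' * r' < 0" using g by linarith+
    then show ?thesis
      using admissible_quadratic_unique_small[OF Q]
        admissible_neg[OF A m] admissible_neg[OF A' m] by simp
  qed
  moreover have "2 * K\<^sup>2 * (p * q * r) = 2 * K'\<^sup>2 * (p' * q' * r')"
    using A A' \<open>K = K'\<close> unfolding admissible_def by simp
  ultimately have gg: "p' * q' * r' = p * q * r" using B(2) by simp
  have F: "(t - p') * (t - q') * (t - r') = (t - p) * (t - q) * (t - r)" for t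
    using vortex_cubic_factor[OF M(1,2) refl, of t]
      vortex_cubic_factor[OF M'(1,2) refl, of t] gg \<open>K = K'\<close> by simp
  have R: "p' = p \<or> p' = q \<or> p' = r" "q' = p \<or> q' = q \<or> q' = r" "r' = p \<or> r' = q \<or> r' = r"
    using F[of p'] F[of q'] F[of r'] by auto
  have oo: "u < v \<longleftrightarrow> u' < v'"
    if "k * u < k * v \<longleftrightarrow> k' * u' < k' * v'" "u \<noteq> v" "u' \<noteq> v'" for u v u' v'
  proof (cases "k > 0")
    case True
    then show ?thesis using that kk by (simp add: mult_less_cancel_left_pos)
  next
    case False
    then have "k < 0" "k' < 0" using k kk by auto
    then show ?thesis using that by (auto simp: mult_less_cancel_left_neg)
  qed
  have o': "p < q \<longleftrightarrow> p' < q'" "p < r \<longleftrightarrow> p' < r'" "q < r \<longleftrightarrow> q' < r'"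
    using oo[OF o(1) d(7,10)] oo[OF o(2) d(8,11)] oo[OF o(3) d(9,12)] by blast+
  have "p' = p \<and> q' = q \<and> r' = r"
    using R o' d by (smt (verit))
  then show "p' = p" "q' = q" "r' = r" by auto
qed

text \<open>The scaled configurations coincide by \<open>balanced_scaled_unique\<close>; the common
  distance between vortices 1 and 2 then makes the scaling factors equal.\<close>

lemma line_equilibrium_unique:
  assumes m: "m > -1"
    and E: "line_equilibrium m (x 1) (x 2) (x 3) (x 4)"
    and E': "line_equilibrium m (x' 1) (x' 2) (x' 3) (x' 4)"
    and o: "\<And>i j. x i < x j \<longleftrightarrow> x' i < x' (j :: 4)"
    and n: "x 1 = x' 1" "x 2 = x' 2"
  shows "x = x'"
proof -
  obtain k K where k: "k \<noteq> 0" "K \<noteq> 0"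
    "balanced m K 1 ((x 1 - x 4) / k) ((x 2 - x 4) / k) ((x 3 - x 4) / k) 0"
    using line_equilibrium_scaled[OF E] by blast
  obtain l L where l: "l \<noteq> 0" "L \<noteq> 0"
    "balanced m L 1 ((x' 1 - x' 4) / l) ((x' 2 - x' 4) / l) ((x' 3 - x' 4) / l) 0"
    using line_equilibrium_scaled[OF E'] by blast
  note d = line_equilibrium_distinct[OF E]
  have c: "k * ((x i - x 4) / k) = x i - x 4" "l * ((x' i - x' 4) / l) = x' i - x' 4" for i
    using k(1) l(1) by simp_all
  have e: "(x' 1 - x' 4) / l = (x 1 - x 4) / k" "(x' 2 - x' 4) / l = (x 2 - x 4) / k"
    "(x' 3 - x' 4) / l = (x 3 - x 4) / k"
    by (rule balanced_scaled_unique[OF m k(1) l(1) k(3,2) l(3,2)]; unfold c; simp add: o)+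
  have e': "(x' 1 - x' 4) * k = (x 1 - x 4) * l" "(x' 2 - x' 4) * k = (x 2 - x 4) * l"
    "(x' 3 - x' 4) * k = (x 3 - x 4) * l"
    using e k(1) l(1) by (simp_all add: field_simps)
  have "(x 1 - x 2) * (k - l) = 0"
    using e'(1,2) n by algebra
  then have "k = l" using d by simp
  then have "x 4 = x' 4" "x 3 = x' 3" using e' n k(1) by auto
  then have "x i = x' i" for i using n exhaust_4[of i] by auto
  then show ?thesis by (rule ext)
qed

text \<open>The scaled positions are not all positive whatever the sign of \<open>k\<close>, so
  their product is negative and \<open>admissible_neg\<close> applies.\<close>

lemma line_equilibrium_interior:
  assumes E: "line_equilibrium m p q r y" and m: "m > -1"
    and "\<not> (p < y \<and> q < y \<and> r < y)" "\<not> (y < p \<and> y < q \<and> y < r)"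
  shows "m > -1/2"
proof -
  obtain k K where k: "k \<noteq> 0" "K \<noteq> 0"
    "balanced m K 1 ((p - y) / k) ((q - y) / k) ((r - y) / k) 0"
    using line_equilibrium_scaled[OF E] by blast
  have "\<not> ((p - y) / k > 0 \<and> (q - y) / k > 0 \<and> (r - y) / k > 0)"
  proof (cases "k > 0")
    case True
    then show ?thesis using assms(4) by (simp add: pos_less_divide_eq)
  next
    case False
    then have "k < 0" using k(1) by simp
    then show ?thesis using assms(3) by (simp add: neg_less_divide_eq)
  qed
  then have "\<not> (p - y) / k * ((q - y) / k) * ((r - y) / k) > 0"
    unfolding balanced_product_pos_iff[OF k(3,2) m] .
  moreover have "(p - y) / k * ((q - y) / k) * ((r - y) / k) \<noteq> 0"
    using k(1) line_equilibrium_distinct[OF E] by simp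
  ultimately have "(p - y) / k * ((q - y) / k) * ((r - y) / k) < 0" by linarith
  then show ?thesis using admissible_neg(2)[OF balanced_imp_admissible[OF k(3,2)] m] by simp
qed

section \<open>Similarity classes and their normalized representatives\<close>

lemma on_axis_eq: "on_axis x i = x i *\<^sub>R axis 1 1"
  by (simp add: on_axis_def vec_eq_iff forall_2 axis_def)

lemma inj_on_axis: "inj (on_axis x) \<longleftrightarrow> inj x"
  by (simp add: inj_def on_axis_eq axis_eq_0_iff)

lemma dist_on_axis: "dist (on_axis x i) (on_axis x j) = \<bar>x i - x j\<bar>"
  by (simp add: dist_norm on_axis_eq flip: scaleR_left_diff_distrib)

lemma collinear_on_axis: "collinear (range (on_axis x))"
  unfolding collinear_def on_axis_eq
  by (intro exI[of _ "axis 1 1"]) (auto simp flip: scaleR_left_diff_distrib)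

lemma relative_equilibrium_on_axis:
  "relative_equilibrium (circulations m) (on_axis x) \<longleftrightarrow>
     line_equilibrium m (x 1) (x 2) (x 3) (x 4)"
proof -
  have U: "UNIV - {1::4} = {2, 3, 4}" "UNIV - {2::4} = {1, 3, 4}"
    "UNIV - {3::4} = {1, 2, 4}" "UNIV - {4::4} = {1, 2, 3}"
    unfolding UNIV_4 by auto
  have trm: "(a / (dist (on_axis x i) (on_axis x j))\<^sup>2) *\<^sub>R (on_axis x j - on_axis x i) =
      (- (a / (x i - x j))) *\<^sub>R axis 1 1" for a i j
  proof -
    \<comment> \<open>At \<open>d = 0\<close> both sides are 0 by the convention for division by
      zero.\<close>
    have "a / d\<^sup>2 * (- d) = - (a / d)" for d :: real
      by (cases "d = 0") (simp_all add: power2_eq_square)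
    from this[of "x i - x j"] have "a / (x i - x j)\<^sup>2 * (x j - x i) = - (a / (x i - x j))"
      by simp
    then show ?thesis
      by (simp add: dist_on_axis on_axis_eq flip: scaleR_left_diff_distrib)
  qed
  have sum: "(\<Sum>j\<in>UNIV - {i}. (circulations m j / (dist (on_axis x i) (on_axis x j))\<^sup>2) *\<^sub>R
      (on_axis x j - on_axis x i)) =
      (- (\<Sum>j\<in>UNIV - {i}. circulations m j / (x i - x j))) *\<^sub>R axis 1 1" for i
    unfolding trm by (simp add: scaleR_sum_left sum_negf)
  have inj: "inj (on_axis x) \<longleftrightarrow> x 1 \<noteq> x 2 \<and> x 1 \<noteq> x 3 \<and> x 2 \<noteq> x 3 \<and> x 1 \<noteq> x 4 \<and> x 2 \<noteq> x 4 \<and> x 3 \<noteq> x 4"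
    unfolding inj_on_axis unfolding inj_def forall_4 by auto
  have circ: "circulations m 1 = 1" "circulations m 2 = 1" "circulations m 3 = 1" "circulations m 4 = m"
    by (simp_all add: circulations_def)
  have sums: "(\<Sum>j\<in>UNIV - {1}. circulations m j / (x 1 - x j)) = 1 / (x 1 - x 2) + 1 / (x 1 - x 3) + m / (x 1 - x 4)"
    "(\<Sum>j\<in>UNIV - {2}. circulations m j / (x 2 - x j)) = 1 / (x 2 - x 1) + 1 / (x 2 - x 3) + m / (x 2 - x 4)"
    "(\<Sum>j\<in>UNIV - {3}. circulations m j / (x 3 - x j)) = 1 / (x 3 - x 1) + 1 / (x 3 - x 2) + m / (x 3 - x 4)"
    "(\<Sum>j\<in>UNIV - {4}. circulations m j / (x 4 - x j)) = 1 / (x 4 - x 1) + 1 / (x 4 - x 2) + 1 / (x 4 - x 3)"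
    unfolding U by (simp_all add: circ)
  \<comment> \<open>The second coordinate only says that the centre lies on the axis, as \<omega> is
    nonzero.\<close>
  have eqn: "- \<omega> *\<^sub>R (on_axis x i - c) = (- s) *\<^sub>R axis 1 1 \<longleftrightarrow> \<omega> * (x i - c $ 1) = s \<and> \<omega> * c $ 2 = 0"
    for \<omega> c i s
    by (auto simp: vec_eq_iff forall_2 on_axis_eq axis_def)
  show ?thesis
  proof
    assume "relative_equilibrium (circulations m) (on_axis x)"
    then obtain \<omega> c where "\<omega> \<noteq> 0" and i: "inj (on_axis x)"
      and "\<forall>i. - \<omega> *\<^sub>R (on_axis x i - c) =
        (- (\<Sum>j\<in>UNIV - {i}. circulations m j / (x i - x j))) *\<^sub>R axis 1 1"
      unfolding relative_equilibrium_def sum by blast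
    then have "\<And>i. \<omega> * (x i - c $ 1) = (\<Sum>j\<in>UNIV - {i}. circulations m j / (x i - x j))"
      unfolding eqn by blast
    from this[of 1] this[of 2] this[of 3] this[of 4]
    have "balanced m \<omega> (c $ 1) (x 1) (x 2) (x 3) (x 4)"
      using i unfolding balanced_def sums inj by blast
    with \<open>\<omega> \<noteq> 0\<close> show "line_equilibrium m (x 1) (x 2) (x 3) (x 4)"
      unfolding line_equilibrium_def by blast
  next
    assume "line_equilibrium m (x 1) (x 2) (x 3) (x 4)"
    then obtain \<omega> c where "\<omega> \<noteq> 0" and B: "balanced m \<omega> c (x 1) (x 2) (x 3) (x 4)"
      unfolding line_equilibrium_def by blast
    have i: "inj (on_axis x)" using B unfolding balanced_def inj by blast
    have "\<forall>i. \<omega> * (x i - (c *\<^sub>R axis 1 1 :: real ^ 2) $ 1) = (\<Sum>j\<in>UNIV - {i}. circulations m j / (x i - x j))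
        \<and> \<omega> * (c *\<^sub>R axis 1 1 :: real ^ 2) $ 2 = 0"
      unfolding forall_4 sums using B unfolding balanced_def by (simp add: axis_def)
    then show "relative_equilibrium (circulations m) (on_axis x)"
      unfolding relative_equilibrium_def sum eqn using i \<open>\<omega> \<noteq> 0\<close> by blast
  qed
qed

section \<open>Similarity invariance and normalization\<close>

lemma similarity_relE:
  assumes "(z, w) \<in> similarity_rel"
  obtains Q :: "real ^ 2 ^ 2" and s b where "rotation_matrix Q" "s > 0"
    "\<And>i. w i = s *\<^sub>R (Q *v z i) + b" "\<And>v. norm (Q *v v) = norm v"
    "\<And>i j. w i - w j = s *\<^sub>R (Q *v (z i - z j))"
proof -
  obtain Q :: "real ^ 2 ^ 2" and s b where *: "rotation_matrix Q" "s > 0"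
      "\<And>i. w i = s *\<^sub>R (Q *v z i) + b"
    using assms unfolding similarity_rel_def by auto
  have "orthogonal_transformation ((*v) Q)"
    using *(1) by (simp add: rotation_matrix_def orthogonal_transformation_matrix)
  then have "norm (Q *v v) = norm v" for v
    by (simp add: orthogonal_transformation)
  moreover have "w i - w j = s *\<^sub>R (Q *v (z i - z j))" for i j
    by (simp add: *(3) matrix_vector_mult_diff_distrib scaleR_right_diff_distrib)
  ultimately show thesis using * that by blast
qed

text \<open>The centre moves with the configuration, and \<omega> becomes
  \<open>\<omega> / s\<^sup>2\<close>.\<close>

lemma relative_equilibrium_similar:
  assumes "relative_equilibrium \<Gamma> z" and "(z, w) \<in> similarity_rel"
  shows "relative_equilibrium \<Gamma> w"
proof -
  obtain Q :: "real ^ 2 ^ 2" and s b where Q: "s > 0" "\<And>i. w i = s *\<^sub>R (Q *v z i) + b"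
    "\<And>v. norm (Q *v v) = norm v" "\<And>i j. w i - w j = s *\<^sub>R (Q *v (z i - z j))"
    using similarity_relE[OF assms(2)] by metis
  obtain \<omega> c where z: "inj z" "\<omega> \<noteq> 0" "\<And>i. - \<omega> *\<^sub>R (z i - c) =
      (\<Sum>j\<in>UNIV - {i}. (\<Gamma> j / (dist (z i) (z j))\<^sup>2) *\<^sub>R (z j - z i))"
    using assms(1) unfolding relative_equilibrium_def by blast
  have dist: "dist (w i) (w j) = s * dist (z i) (z j)" for i j
    using Q by (simp add: dist_norm)
  have "inj w"
    using dist z(1) Q(1) by (metis (no_types, lifting) dist_eq_0_iff inj_def mult_eq_0_iff less_irrefl)
  have "- (\<omega> / s\<^sup>2) *\<^sub>R (w i - (s *\<^sub>R (Q *v c) + b)) =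
      (\<Sum>j\<in>UNIV - {i}. (\<Gamma> j / (dist (w i) (w j))\<^sup>2) *\<^sub>R (w j - w i))" for i
  proof -
    have "w i - (s *\<^sub>R (Q *v c) + b) = s *\<^sub>R (Q *v (z i - c))"
      by (simp add: Q(2) matrix_vector_mult_diff_distrib scaleR_right_diff_distrib)
    then have "- (\<omega> / s\<^sup>2) *\<^sub>R (w i - (s *\<^sub>R (Q *v c) + b)) = (1 / s) *\<^sub>R (Q *v (- \<omega> *\<^sub>R (z i - c)))"
      using Q(1)
      by (simp add: matrix_vector_mult_scaleR power2_eq_square linear_neg[OF matrix_vector_mul_linear])
    also have "\<dots> = (\<Sum>j\<in>UNIV - {i}. (1 / s) *\<^sub>R (Q *v ((\<Gamma> j / (dist (z i) (z j))\<^sup>2) *\<^sub>R (z j - z i))))"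
      unfolding z(3) by (simp add: linear_sum[OF matrix_vector_mul_linear] scaleR_sum_right)
    also have "\<dots> = (\<Sum>j\<in>UNIV - {i}. (\<Gamma> j / (dist (w i) (w j))\<^sup>2) *\<^sub>R (w j - w i))"
      unfolding dist Q(4) using Q(1)
      by (intro sum.cong refl) (simp add: matrix_vector_mult_scaleR power2_eq_square)
    finally show ?thesis .
  qed
  moreover have "\<omega> / s\<^sup>2 \<noteq> 0" using z(2) Q(1) by simp
  ultimately show ?thesis
    unfolding relative_equilibrium_def using \<open>inj w\<close> by blast
qed

lemma ex_similar_on_axis:
  fixes z :: config
  assumes "inj z" "collinear (range z)"
  obtains x where "(z, on_axis x) \<in> similarity_rel" "x 1 = -1" "x 2 = 1"
proof -
  obtain u where u: "\<And>i j. \<exists>a. z i - z j = a *\<^sub>R u"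
    using assms(2) unfolding collinear_def by blast
  have "\<forall>i. \<exists>a. z i - z 1 = a *\<^sub>R u" using u by blast
  from choice[OF this] obtain t where t: "\<And>i. z i - z 1 = t i *\<^sub>R u" by blast
  define v where "v = z 2 - z 1"
  have v: "v \<noteq> 0" unfolding v_def using assms(1) by (simp add: inj_eq)
  have t2: "t 2 \<noteq> 0" using v t[of 2] unfolding v_def by auto
  have zi: "z i = z 1 + (t i / t 2) *\<^sub>R v" for i
    using t[of i] t[of 2] t2 unfolding v_def by (simp add: algebra_simps)
  have "t 1 *\<^sub>R u = 0" using t[of 1] by simp
  moreover have "u \<noteq> 0" using v t[of 2] unfolding v_def by auto
  ultimately have t1: "t 1 = 0" by simp
  obtain A :: "real ^ 2 ^ 2" where A: "rotation_matrix A" "A *v axis 1 1 = (1 / norm v) *\<^sub>R v"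
    using rotation_matrix_exists_basis[of "(1 / norm v) *\<^sub>R v" 1] v by auto
  define Q where "Q = transpose A"
  have QA: "Q ** A = mat 1"
    using A(1) unfolding Q_def by (simp add: rotation_matrix_def orthogonal_matrix)
  have Qrot: "rotation_matrix Q"
    using A(1) unfolding Q_def
    by (simp add: rotation_matrix_def orthogonal_matrix_transpose det_transpose)
  have "v = norm v *\<^sub>R (A *v axis 1 1)" using A(2) v by simp
  then have "Q *v v = norm v *\<^sub>R (Q *v (A *v axis 1 1))"
    by (metis matrix_vector_mult_scaleR)
  then have Qv: "Q *v v = norm v *\<^sub>R axis 1 1"
    by (simp add: matrix_vector_mul_assoc QA)
  \<comment> \<open>Chosen so that vortices 1 and 2 land at -1 and 1 once \<open>Q\<close> has
    turned \<open>v\<close> onto the positive axis.\<close>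
  define s b where "s = 2 / norm v" and "b = - axis 1 1 - s *\<^sub>R (Q *v z 1)"
  define x where "x i = 2 * (t i / t 2) - 1" for i
  have "on_axis x i = s *\<^sub>R (Q *v z i) + b" for i
  proof -
    have "s *\<^sub>R (Q *v z i) + b = (s * (t i / t 2)) *\<^sub>R (Q *v v) - axis 1 1"
      unfolding b_def by (subst zi) (simp add: matrix_vector_right_distrib matrix_vector_mult_scaleR algebra_simps)
    also have "\<dots> = x i *\<^sub>R axis 1 1"
      unfolding Qv x_def s_def using v by (simp add: algebra_simps)
    finally show ?thesis unfolding on_axis_eq by simp
  qed
  moreover have "s > 0" unfolding s_def using v by simp
  ultimately have "(z, on_axis x) \<in> similarity_rel"
    unfolding similarity_rel_def using Qrot by blast
  then show thesis using that[of x] t1 t2 unfolding x_def by simp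
qed

text \<open>Both configurations have the same difference between vortices 2 and 1, so the linear
  part of the similarity fixes the axis vector.\<close>

lemma similar_on_axis_unique:
  assumes "(on_axis x, on_axis y) \<in> similarity_rel"
    and "x 1 = -1" "x 2 = 1" "y 1 = -1" "y 2 = 1"
  shows "x = y"
proof
  fix i
  obtain Q :: "real ^ 2 ^ 2" and s where Q: "\<And>i j. on_axis y i - on_axis y j = s *\<^sub>R (Q *v (on_axis x i - on_axis x j))"
    using similarity_relE[OF assms(1)] by metis
  have D: "(y i - y j) *\<^sub>R axis 1 1 = (x i - x j) *\<^sub>R (s *\<^sub>R (Q *v axis 1 1))" for i j
    using Q[of i j] unfolding on_axis_eq
    by (simp add: matrix_vector_mult_scaleR mult.commute flip: scaleR_left_diff_distrib)
  have "y 2 - y 1 = 2" "x 2 - x 1 = 2" using assms by simp_all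
  then have "s *\<^sub>R (Q *v axis 1 1) = axis 1 1"
    using D[of 2 1] by (simp only: scaleR_cancel_left) simp
  then have "(y i - y 1) *\<^sub>R axis 1 1 = (x i - x 1) *\<^sub>R (axis 1 1 :: real ^ 2)"
    using D[of i 1] by simp
  then show "x i = y i" using assms by (simp add: axis_eq_0_iff)
qed

definition normalized_equilibria :: "real \<Rightarrow> (4 \<Rightarrow> real) set" where
  "normalized_equilibria m =
     {x. x 1 = -1 \<and> x 2 = 1 \<and> line_equilibrium m (x 1) (x 2) (x 3) (x 4)}"

definition axis_class :: "(4 \<Rightarrow> real) \<Rightarrow> config set" where
  "axis_class x = similarity_rel `` {on_axis x}"

lemma on_axis_in_axis_class_iff:
  assumes "x 1 = -1" "x 2 = 1" "y 1 = -1" "y 2 = 1"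
  shows "on_axis y \<in> axis_class x \<longleftrightarrow> y = x"
  using similar_on_axis_unique[of x y] assms equiv_similarity_rel
  unfolding axis_class_def by (auto simp: equiv_def refl_on_def)

lemma collinear_classes_eq:
  "collinear_classes (circulations m) = axis_class ` normalized_equilibria m"
proof
  show "collinear_classes (circulations m) \<subseteq> axis_class ` normalized_equilibria m"
  proof
    fix C assume "C \<in> collinear_classes (circulations m)"
    then obtain z where z: "relative_equilibrium (circulations m) z" "collinear (range z)"
      "C = similarity_rel `` {z}"
      unfolding collinear_classes_def collinear_relative_equilibria_def
      by (auto elim: quotientE)
    have "inj z" using z(1) unfolding relative_equilibrium_def by blast
    then obtain x where x: "(z, on_axis x) \<in> similarity_rel" "x 1 = -1" "x 2 = 1"
      using ex_similar_on_axis z(2) by blast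
    have "line_equilibrium m (x 1) (x 2) (x 3) (x 4)"
      using relative_equilibrium_similar[OF z(1) x(1)] relative_equilibrium_on_axis by blast
    then have "x \<in> normalized_equilibria m" using x unfolding normalized_equilibria_def by simp
    moreover have "C = axis_class x"
      unfolding z(3) axis_class_def by (rule equiv_class_eq[OF equiv_similarity_rel x(1)])
    ultimately show "C \<in> axis_class ` normalized_equilibria m" by blast
  qed
  show "axis_class ` normalized_equilibria m \<subseteq> collinear_classes (circulations m)"
    unfolding collinear_classes_def collinear_relative_equilibria_def axis_class_def
      normalized_equilibria_def
    by (auto intro!: quotientI simp: relative_equilibrium_on_axis collinear_on_axis)
qed

fun ordered_as :: "(4 \<Rightarrow> real) \<Rightarrow> 4 \<times> 4 \<times> 4 \<times> 4 \<Rightarrow> bool" where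
  "ordered_as x (i, j, k, l) \<longleftrightarrow> x i < x j \<and> x j < x k \<and> x k < x l"

text \<open>The class has only one normalized member on the axis, so the existential in
  \<open>has_ordering\<close> can only be witnessed by \<open>x\<close>.\<close>

lemma has_ordering_axis_class:
  assumes "x \<in> normalized_equilibria m"
  shows "has_ordering (axis_class x) \<sigma> \<longleftrightarrow> ordered_as x \<sigma>"
proof -
  obtain i j k l where "\<sigma> = (i, j, k, l)" by (cases \<sigma>)
  then show ?thesis
    using assms on_axis_in_axis_class_iff[of x] unfolding normalized_equilibria_def by auto
qed

lemma inj_on_axis_class: "inj_on axis_class (normalized_equilibria m)"
proof (rule inj_onI)
  fix x y assume xy: "x \<in> normalized_equilibria m" "y \<in> normalized_equilibria m"
    and eq: "axis_class x = axis_class y"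
  have "on_axis x \<in> axis_class y"
    using on_axis_in_axis_class_iff[of x x] xy eq unfolding normalized_equilibria_def by auto
  then show "x = y"
    using on_axis_in_axis_class_iff[of y x] xy unfolding normalized_equilibria_def by auto
qed

lemma ordered_as_comparisons:
  assumes "ordered_as x \<sigma>"
  obtains i j k l where "\<sigma> = (i, j, k, l)" "UNIV = {i, j, k, l}"
    "x i < x j" "x i < x k" "x i < x l" "x j < x k" "x j < x l" "x k < x l"
proof -
  obtain i j k l where s: "\<sigma> = (i, j, k, l)" by (cases \<sigma>)
  then have o: "x i < x j" "x j < x k" "x k < x l" using assms by auto
  then have "x i < x k" "x j < x l" "x i < x l" by linarith+
  with o have "i \<noteq> j" "i \<noteq> k" "i \<noteq> l" "j \<noteq> k" "j \<noteq> l" "k \<noteq> l"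
    by blast+
  then have "card {i, j, k, l} = 4" by simp
  then have "UNIV = {i, j, k, l}" by (intro card_subset_eq[symmetric]) auto
  then show thesis using that s o \<open>x i < x k\<close> \<open>x j < x l\<close> \<open>x i < x l\<close> by blast
qed

section \<open>Counting the orderings\<close>

text \<open>Both orderings list the range of \<open>x\<close> in increasing order, so the lists of
  values agree; as the values are distinct, so do the indices.\<close>

lemma ordered_as_unique:
  assumes "ordered_as x \<sigma>" "ordered_as x \<tau>"
  shows "\<sigma> = \<tau>"
proof -
  obtain i j k l where s: "\<sigma> = (i, j, k, l)" "UNIV = {i, j, k, l}"
    "x i < x j" "x i < x k" "x i < x l" "x j < x k" "x j < x l" "x k < x l"
    using ordered_as_comparisons[OF assms(1)] by blast
  obtain i' j' k' l' where t: "\<tau> = (i', j', k', l')" "UNIV = {i', j', k', l'}"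
    "x i' < x j'" "x i' < x k'" "x i' < x l'" "x j' < x k'" "x j' < x l'" "x k' < x l'"
    using ordered_as_comparisons[OF assms(2)] by blast
  have "set (map x [i, j, k, l]) = range x" "set (map x [i', j', k', l']) = range x"
    using arg_cong[OF s(2), of "image x"] arg_cong[OF t(2), of "image x"] by simp_all
  moreover have "sorted_wrt (<) (map x [i, j, k, l])" "sorted_wrt (<) (map x [i', j', k', l'])"
    using s t by simp_all
  ultimately have "map x [i', j', k', l'] = map x [i, j, k, l]"
    by (intro strict_sorted_equal) simp_all
  then have eq: "x i' = x i" "x j' = x j" "x k' = x k" "x l' = x l" by simp_all
  have "a \<in> {i, j, k, l}" for a using s(2) by blast
  then have mem: "a = i \<or> a = j \<or> a = k \<or> a = l" for a by blast
  have "i' = i" "j' = j" "k' = k" "l' = l"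
    using mem[of i'] mem[of j'] mem[of k'] mem[of l'] eq s(3-8) by (metis less_irrefl)+
  then show ?thesis unfolding s t by simp
qed

lemma ordered_as_less_iff:
  assumes "ordered_as x \<sigma>" "ordered_as y \<sigma>"
  shows "x a < x b \<longleftrightarrow> y a < y b"
proof -
  obtain i j k l where s: "\<sigma> = (i, j, k, l)" "UNIV = {i, j, k, l}"
    and x: "x i < x j" "x i < x k" "x i < x l" "x j < x k" "x j < x l" "x k < x l"
    using ordered_as_comparisons[OF assms(1)] by blast
  have y: "y i < y j" "y i < y k" "y i < y l" "y j < y k" "y j < y l" "y k < y l"
    using assms(2) unfolding s by auto
  have "a \<in> {i, j, k, l}" "b \<in> {i, j, k, l}" using s(2) by blast+
  then show ?thesis using x y by (elim insertE emptyE) (simp_all add: not_less_iff_gr_or_eq)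
qed

lemma ex_ordering:
  assumes "x 1 < x 2" "x 1 \<noteq> x 3" "x 2 \<noteq> x 3" "x 1 \<noteq> x 4" "x 2 \<noteq> x 4" "x 3 \<noteq> x 4"
  shows "\<exists>\<sigma> \<in> group_I \<union> group_II. ordered_as x \<sigma>"
  using assms unfolding group_I_def group_II_def bex_Un bex_simps ordered_as.simps by argo

lemma ordered_as_group_II:
  assumes "ordered_as x \<sigma>" "\<sigma> \<in> group_II"
  shows "\<not> (x 1 < x 4 \<and> x 2 < x 4 \<and> x 3 < x 4)" "\<not> (x 4 < x 1 \<and> x 4 < x 2 \<and> x 4 < x 3)"
  using assms unfolding group_II_def by auto

lemma normalized_equilibria_unique:
  assumes "m > -1" "x \<in> normalized_equilibria m" "y \<in> normalized_equilibria m"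
    and "ordered_as x \<sigma>" "ordered_as y \<sigma>"
  shows "x = y"
proof (rule line_equilibrium_unique[OF assms(1)])
  show "x i < x j \<longleftrightarrow> y i < y j" for i j
    using ordered_as_less_iff[OF assms(4,5)] .
qed (use assms(2,3) in \<open>auto simp: normalized_equilibria_def\<close>)

lemma normalized_equilibria_ordering:
  assumes "x \<in> normalized_equilibria m"
  shows "\<exists>\<sigma> \<in> group_I \<union> group_II. ordered_as x \<sigma>"
  using assms line_equilibrium_distinct[of m "x 1" "x 2" "x 3" "x 4"]
  unfolding normalized_equilibria_def by (intro ex_ordering) auto

lemma normalized_equilibria_ordering_I:
  assumes "x \<in> normalized_equilibria m" and m: "-1 < m" "m \<le> -1/2"
  shows "\<exists>\<sigma> \<in> group_I. ordered_as x \<sigma>"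
proof -
  obtain \<sigma> where s: "\<sigma> \<in> group_I \<union> group_II" "ordered_as x \<sigma>"
    using normalized_equilibria_ordering[OF assms(1)] by blast
  have E: "line_equilibrium m (x 1) (x 2) (x 3) (x 4)"
    using assms(1) unfolding normalized_equilibria_def by blast
  have "\<sigma> \<notin> group_II"
    using line_equilibrium_interior[OF E m(1)] ordered_as_group_II[OF s(2)] m(2) by fastforce
  with s show ?thesis by blast
qed

section \<open>Realizing every ordering\<close>

lemma ex_normalized:
  assumes E: "line_equilibrium m (f 1) (f 2) (f 3) (f 4)" and f: "f 1 < f 2"
  shows "\<exists>x \<in> normalized_equilibria m. \<forall>\<sigma>. ordered_as f \<sigma> \<longrightarrow> ordered_as x \<sigma>"
proof -
  \<comment> \<open>The increasing affine map that sends \<open>f 1\<close> to -1 and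
    \<open>f 2\<close> to 1.\<close>
  define a b where "a = 2 / (f 2 - f 1)" and "b = - 1 - a * f 1"
  define x where "x i = a * f i + b" for i
  have a: "a > 0" unfolding a_def using f by simp
  have "f 2 - f 1 \<noteq> 0" using f by simp
  then have "a * (f 2 - f 1) = 2" unfolding a_def by (metis nonzero_eq_divide_eq)
  then have "x 1 = -1" "x 2 = 1" unfolding x_def b_def by (simp_all add: algebra_simps)
  moreover have "line_equilibrium m (x 1) (x 2) (x 3) (x 4)"
    unfolding x_def using line_equilibrium_affine[OF E] a by simp
  ultimately have "x \<in> normalized_equilibria m" unfolding normalized_equilibria_def by simp
  moreover have "x i < x j \<longleftrightarrow> f i < f j" for i j unfolding x_def using a by simp
  then have "ordered_as f \<sigma> \<longrightarrow> ordered_as x \<sigma>" for \<sigma> by (cases \<sigma>) simp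
  ultimately show ?thesis by blast
qed

definition quad :: "real \<Rightarrow> real \<Rightarrow> real \<Rightarrow> real \<Rightarrow> 4 \<Rightarrow> real" where
  "quad p q r y = (\<lambda>i. if i = 1 then p else if i = 2 then q else if i = 3 then r else y)"

lemma quad_simps [simp]:
  "quad p q r y 1 = p" "quad p q r y 2 = q" "quad p q r y 3 = r" "quad p q r y 4 = y"
  by (simp_all add: quad_def)

text \<open>One equilibrium serves six orderings: choose the position that carries label 3, give
  labels 1 and 2 to the others in increasing order, and optionally reflect first.\<close>

lemma ex_normalized_relabelled:
  assumes E: "line_equilibrium m p q r 0" and o: "p < q" "q < r"
    and f: "f \<in> {quad p q r 0, quad p r q 0, quad q r p 0,
      quad (- r) (- q) (- p) 0, quad (- r) (- p) (- q) 0, quad (- q) (- p) (- r) 0}"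
    and "ordered_as f \<sigma>"
  shows "\<exists>x \<in> normalized_equilibria m. ordered_as x \<sigma>"
proof -
  note E2 = line_equilibrium_swap(2)[OF E]
  note E3 = line_equilibrium_swap(2)[OF line_equilibrium_swap(1)[OF E]]
  note E4 = line_equilibrium_swap(1)[OF E3]
  note E5 = line_equilibrium_swap(1)[OF E2]
  note E6 = line_equilibrium_swap(1)[OF E]
  have N: "line_equilibrium m (- a) (- b) (- c) 0" if "line_equilibrium m a b c 0" for a b c
    using line_equilibrium_uminus[OF that] by simp
  have "line_equilibrium m (f 1) (f 2) (f 3) (f 4) \<and> f 1 < f 2"
    using f o E E2 E3 N[OF E4] N[OF E5] N[OF E3] N[OF E6] N[OF E2] N[OF E]
    by (elim insertE emptyE) simp_all
  then show ?thesis using ex_normalized[of m f] assms(5) by blast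
qed

lemma ex_normalized_group_I:
  assumes m: "m > -1" and s: "\<sigma> \<in> group_I"
  shows "\<exists>x \<in> normalized_equilibria m. ordered_as x \<sigma>"
proof -
  obtain K p q r where "K \<noteq> 0" and o: "0 < p" "p < q" "q < r" and "balanced m K 1 p q r 0"
    using ex_balanced_exterior[OF m] by blast
  then have E: "line_equilibrium m p q r 0" unfolding line_equilibrium_def by blast
  note R = ex_normalized_relabelled[OF E o(2,3)]
  from s consider "\<sigma> = (4,1,2,3)" | "\<sigma> = (4,1,3,2)" | "\<sigma> = (4,3,1,2)"
    | "\<sigma> = (1,2,3,4)" | "\<sigma> = (1,3,2,4)" | "\<sigma> = (3,1,2,4)"
    unfolding group_I_def by blast
  then show ?thesis
  proof cases
    case 1 then show ?thesis using o by (intro R[of "quad p q r 0"]) simp_all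
  next
    case 2 then show ?thesis using o by (intro R[of "quad p r q 0"]) simp_all
  next
    case 3 then show ?thesis using o by (intro R[of "quad q r p 0"]) simp_all
  next
    case 4 then show ?thesis using o by (intro R[of "quad (- r) (- q) (- p) 0"]) simp_all
  next
    case 5 then show ?thesis using o by (intro R[of "quad (- r) (- p) (- q) 0"]) simp_all
  next
    case 6 then show ?thesis using o by (intro R[of "quad (- q) (- p) (- r) 0"]) simp_all
  qed
qed

lemma ex_normalized_group_II:
  assumes m: "m > -1/2" and s: "\<sigma> \<in> group_II"
  shows "\<exists>x \<in> normalized_equilibria m. ordered_as x \<sigma>"
proof -
  obtain K p q r where "K \<noteq> 0" and o: "p < 0" "0 < q" "q < r" and "balanced m K 1 p q r 0"
    using ex_balanced_interior[OF m] by blast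
  then have E: "line_equilibrium m p q r 0" unfolding line_equilibrium_def by blast
  have "p < q" using o by simp
  note R = ex_normalized_relabelled[OF E this o(3)]
  from s consider "\<sigma> = (1,4,2,3)" | "\<sigma> = (1,4,3,2)" | "\<sigma> = (3,4,1,2)"
    | "\<sigma> = (1,2,4,3)" | "\<sigma> = (1,3,4,2)" | "\<sigma> = (3,1,4,2)"
    unfolding group_II_def by blast
  then show ?thesis
  proof cases
    case 1 then show ?thesis using o by (intro R[of "quad p q r 0"]) simp_all
  next
    case 2 then show ?thesis using o by (intro R[of "quad p r q 0"]) simp_all
  next
    case 3 then show ?thesis using o by (intro R[of "quad q r p 0"]) simp_all
  next
    case 4 then show ?thesis using o by (intro R[of "quad (- r) (- q) (- p) 0"]) simp_all
  next
    case 5 then show ?thesis using o by (intro R[of "quad (- r) (- p) (- q) 0"]) simp_all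
  next
    case 6 then show ?thesis using o by (intro R[of "quad (- q) (- p) (- r) 0"]) simp_all
  qed
qed

text \<open>Existence, uniqueness and exhaustiveness make orderings in \<open>S\<close> and
  normalized equilibria correspond bijectively; \<open>axis_class\<close> carries this over to
  classes.\<close>

lemma classes_one_for_each_ordering:
  assumes m: "m > -1"
    and ex: "\<And>\<sigma>. \<sigma> \<in> S \<Longrightarrow> \<exists>x \<in> normalized_equilibria m. ordered_as x \<sigma>"
    and all: "\<And>x. x \<in> normalized_equilibria m \<Longrightarrow> \<exists>\<sigma> \<in> S. ordered_as x \<sigma>"
  shows "card (collinear_classes (circulations m)) = card S \<and>
    one_for_each_ordering (collinear_classes (circulations m)) S"
proof
  let ?X = "normalized_equilibria m"
  note uniq = normalized_equilibria_unique[OF m]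
  have "\<forall>\<sigma>\<in>S. \<exists>x. x \<in> ?X \<and> ordered_as x \<sigma>" using ex by blast
  then obtain g where g: "\<And>\<sigma>. \<sigma> \<in> S \<Longrightarrow> g \<sigma> \<in> ?X" "\<And>\<sigma>. \<sigma> \<in> S \<Longrightarrow> ordered_as (g \<sigma>) \<sigma>"
    by (metis (no_types) bchoice)
  have "inj_on g S"
    using g(2) ordered_as_unique by (metis inj_onI)
  moreover have "g ` S = ?X"
  proof
    show "g ` S \<subseteq> ?X" using g(1) by blast
    show "?X \<subseteq> g ` S"
    proof
      fix x assume x: "x \<in> ?X"
      then obtain \<sigma> where "\<sigma> \<in> S" "ordered_as x \<sigma>" using all by blast
      then have "x = g \<sigma>" using uniq x g by blast
      with \<open>\<sigma> \<in> S\<close> show "x \<in> g ` S" by blast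
    qed
  qed
  ultimately have "card ?X = card S" using card_image by metis
  then show "card (collinear_classes (circulations m)) = card S"
    unfolding collinear_classes_eq by (simp add: card_image inj_on_axis_class)
  show "one_for_each_ordering (collinear_classes (circulations m)) S"
    unfolding one_for_each_ordering_def collinear_classes_eq
  proof (intro conjI ballI)
    fix \<sigma> assume "\<sigma> \<in> S"
    then obtain x where x: "x \<in> ?X" "ordered_as x \<sigma>" using ex by blast
    show "\<exists>!C. C \<in> axis_class ` ?X \<and> has_ordering C \<sigma>"
    proof (rule ex1I[of _ "axis_class x"])
      show "axis_class x \<in> axis_class ` ?X \<and> has_ordering (axis_class x) \<sigma>"
        using x has_ordering_axis_class by blast
      fix C assume "C \<in> axis_class ` ?X \<and> has_ordering C \<sigma>"
      then obtain y where y: "y \<in> ?X" "C = axis_class y" "ordered_as y \<sigma>"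
        using has_ordering_axis_class by blast
      then show "C = axis_class x" using uniq[OF y(1) x(1) y(3) x(2)] by simp
    qed
  next
    fix C assume "C \<in> axis_class ` ?X"
    then obtain x where x: "x \<in> ?X" "C = axis_class x" by blast
    obtain \<sigma> where s: "\<sigma> \<in> S" "ordered_as x \<sigma>" using all x by blast
    have h: "has_ordering C \<tau> \<longleftrightarrow> \<tau> = \<sigma>" for \<tau>
      unfolding x(2) has_ordering_axis_class[OF x(1)] using ordered_as_unique s by blast
    show "\<exists>!\<sigma>. has_ordering C \<sigma>" unfolding h by blast
    show "\<forall>\<sigma>. has_ordering C \<sigma> \<longrightarrow> \<sigma> \<in> S" unfolding h using s by blast
  qed
qed

theorem theorem2p11:
  fixes m :: real
  defines "\<C> \<equiv> collinear_classes (circulations m)"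
  shows "(m > - 1 / 2 \<longrightarrow> card \<C> = 12 \<and> one_for_each_ordering \<C> (group_I \<union> group_II)) \<and>
         (- 1 < m \<and> m \<le> - 1 / 2 \<longrightarrow> card \<C> = 6 \<and> one_for_each_ordering \<C> group_I) \<and>
         (m \<le> - 1 \<longrightarrow> \<C> = {})"
proof (intro conjI impI)
  have card: "card (group_I \<union> group_II) = 12" "card group_I = 6"
    unfolding group_I_def group_II_def by simp_all
  {
    assume m: "m > - 1 / 2"
    then have "\<exists>x \<in> normalized_equilibria m. ordered_as x \<sigma>" if "\<sigma> \<in> group_I \<union> group_II" for \<sigma>
      using that m ex_normalized_group_I[of m \<sigma>] ex_normalized_group_II[of m \<sigma>] by fastforce
    then have "card \<C> = card (group_I \<union> group_II) \<and> one_for_each_ordering \<C> (group_I \<union> group_II)"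
      unfolding \<C>_def using m normalized_equilibria_ordering
      by (intro classes_one_for_each_ordering) auto
    then show "card \<C> = 12" "one_for_each_ordering \<C> (group_I \<union> group_II)"
      unfolding card by blast+
  }
  {
    assume m: "- 1 < m \<and> m \<le> - 1 / 2"
    then have "card \<C> = card group_I \<and> one_for_each_ordering \<C> group_I"
      unfolding \<C>_def using normalized_equilibria_ordering_I ex_normalized_group_I
      by (intro classes_one_for_each_ordering) auto
    then show "card \<C> = 6" "one_for_each_ordering \<C> group_I"
      unfolding card by blast+
  }
  {
    assume "m \<le> - 1"
    then show "\<C> = {}"
      unfolding \<C>_def collinear_classes_eq normalized_equilibria_def
      using not_line_equilibrium by simp
  }
qed

end
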